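(* Let $\Omega\subset\mathbb{C}$ be a finitely connected domain that is either conformally equivalent to a (non-degenerate) annulus or has two or more holes. Then no weighted composition operator on $H(\Omega)$ can be supercyclic; that is, for all holomorphic $\omega:\Omega\to\mathbb{C}$ and $\psi:\Omega\to\Omega$, the operator $C_{\omega,\psi}$ is not supercyclic on $H(\Omega)$.
   Context: A hole of a domain $\Omega\subseteq\mathbb{C}$ is a bounded connected component of $\mathbb{C}\setminus\Omega$. $\Omega$ is finitely connected if it has only finitely many holes. A (non-degenerate) annulus is a set $A(r)=\{z\in\mathbb{C}:1<|z|<r\}$ with $1<r<\infty$. $H(\Omega)$ is the space of holomorphic functions on $\Omega$ with the compact-open topology. For holomorphic $\omega:\Omega\to\mathbb{C}$ and $\psi:\Omega\to\Omega$, the weighted composition operator $C_{\omega,\psi}:H(\Omega)\to H(\Omega)$ is $C_{\omega,\psi}(f)(z)=\omega(z)\,f(\psi(z))$. An operator (continuous linear self-map) $T$ on a topological vector space $X$ is supercyclic if for some $f\in X$ the set $\{\lambda T^nf:\lambda\in\mathbb{C},\ n=0,1,\dots\}$ is dense in $X$. *)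

theory Defs
  imports "HOL-Complex_Analysis.Complex_Analysis"
begin

definition complex_domain :: "complex set \<Rightarrow> bool" where
  "complex_domain \<Omega> \<longleftrightarrow> open \<Omega> \<and> connected \<Omega> \<and> \<Omega> \<noteq> {}"

definition holes :: "complex set \<Rightarrow> complex set set" where
  "holes \<Omega> = {C \<in> components (- \<Omega>). bounded C}"

definition finitely_connected :: "complex set \<Rightarrow> bool" where
  "finitely_connected \<Omega> \<longleftrightarrow> finite (holes \<Omega>)"

definition annulus :: "real \<Rightarrow> complex set" where
  "annulus r = {z. 1 < cmod z \<and> cmod z < r}"

definition conformally_equivalent :: "complex set \<Rightarrow> complex set \<Rightarrow> bool" where
  "conformally_equivalent S T \<longleftrightarrow>
     (\<exists>f g. f holomorphic_on S \<and> g holomorphic_on T \<and>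
            (\<forall>z\<in>S. f z \<in> T \<and> g (f z) = z) \<and>
            (\<forall>w\<in>T. g w \<in> S \<and> f (g w) = w))"

text \<open>A holomorphic function on \<open>\<Omega>\<close> is represented by its extension by zero to the whole plane.
  The representative is then unique, and the space is closed under the pointwise operations.\<close>

definition hol_space :: "complex set \<Rightarrow> (complex \<Rightarrow> complex) set" where
  "hol_space \<Omega> = {f. f holomorphic_on \<Omega> \<and> (\<forall>z. z \<notin> \<Omega> \<longrightarrow> f z = 0)}"

text \<open>The compact-open topology, given by its standard subbasis. Taking \<open>K = {}\<close> shows that the
  underlying set is \<open>hol_space \<Omega>\<close>.\<close>

definition hol_topology :: "complex set \<Rightarrow> (complex \<Rightarrow> complex) topology" where
  "hol_topology \<Omega> = topology_generated_by
     {{f \<in> hol_space \<Omega>. f ` K \<subseteq> U} | K U. compact K \<and> K \<subseteq> \<Omega> \<and> open U}"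

lemma topspace_hol_topology [simp]: "topspace (hol_topology \<Omega>) = hol_space \<Omega>"
proof -
  have "hol_space \<Omega> = {f \<in> hol_space \<Omega>. f ` {} \<subseteq> UNIV}"
    by simp
  then have "hol_space \<Omega> \<in> {{f \<in> hol_space \<Omega>. f ` K \<subseteq> U} | K U. compact K \<and> K \<subseteq> \<Omega> \<and> open U}"
    by blast
  then show ?thesis
    unfolding hol_topology_def topology_generated_by_topspace by blast
qed

definition weighted_comp ::
    "complex set \<Rightarrow> (complex \<Rightarrow> complex) \<Rightarrow> (complex \<Rightarrow> complex) \<Rightarrow>
     (complex \<Rightarrow> complex) \<Rightarrow> (complex \<Rightarrow> complex)" where
  "weighted_comp \<Omega> \<omega> \<psi> f = (\<lambda>z. if z \<in> \<Omega> then \<omega> z * f (\<psi> z) else 0)"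

lemma weighted_comp_in_hol_space:
  assumes "\<omega> holomorphic_on \<Omega>" "\<psi> holomorphic_on \<Omega>" "\<psi> ` \<Omega> \<subseteq> \<Omega>" "f \<in> hol_space \<Omega>"
  shows "weighted_comp \<Omega> \<omega> \<psi> f \<in> hol_space \<Omega>"
proof -
  have "(f \<circ> \<psi>) holomorphic_on \<Omega>"
    using assms by (auto simp: hol_space_def intro: holomorphic_on_compose_gen)
  then have "(\<lambda>z. \<omega> z * f (\<psi> z)) holomorphic_on \<Omega>"
    using assms(1) by (auto simp: o_def intro: holomorphic_on_mult)
  moreover have "weighted_comp \<Omega> \<omega> \<psi> f holomorphic_on \<Omega> \<longleftrightarrow>
                 (\<lambda>z. \<omega> z * f (\<psi> z)) holomorphic_on \<Omega>"
    by (rule holomorphic_cong) (auto simp: weighted_comp_def)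
  ultimately show ?thesis
    by (auto simp: hol_space_def weighted_comp_def)
qed

text \<open>Supercyclicity of a self-map \<open>T\<close> of the space \<open>X\<close> with scalar multiplication \<open>smul\<close>.
  Linearity and continuity of \<open>T\<close> are not part of the predicate, so that its negation always
  says that no projective orbit is dense.\<close>

definition supercyclic_on ::
    "(complex \<Rightarrow> 'a \<Rightarrow> 'a) \<Rightarrow> 'a topology \<Rightarrow> ('a \<Rightarrow> 'a) \<Rightarrow> bool" where
  "supercyclic_on smul X T \<longleftrightarrow>
     (\<exists>f \<in> topspace X. X closure_of {smul c ((T ^^ n) f) | c n. True} = topspace X)"

definition fun_scale :: "complex \<Rightarrow> (complex \<Rightarrow> complex) \<Rightarrow> (complex \<Rightarrow> complex)" where
  "fun_scale c f = (\<lambda>z. c * f z)"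

end

theory Submission
  imports Defs
begin

text \<open>
  Suppose that \<open>T f = \<omega> \<cdot> (f \<circ> \<psi>)\<close> has a vector \<open>f\<close> whose orbit is dense up to scalars. A continuous
  linear functional that kills \<open>T\<^sup>n f\<close> for all large \<open>n\<close> must then be zero
  (\<open>functional_vanishing_on_tail\<close>). Applied to evaluations, this shows that \<open>\<omega>\<close> has no zeros and
  that \<open>\<psi>\<close> is injective; applied to \<open>F \<mapsto> \<integral>\<^sub>\<gamma> F \<psi>' / \<omega>\<close>, it shows that if all functions holomorphic on \<open>\<Omega>\<close>
  have integral zero over \<open>\<psi> \<circ> \<gamma>\<close>, then they have integral zero over \<open>\<gamma>\<close> (\<open>null_loop_pullback\<close>). So
  \<open>\<psi>\<close> and its iterates are injective on homology.

  As \<open>T\<^sup>n f\<close> is \<open>f \<circ> \<psi>\<^sup>n\<close> times a function without zeros, its zeros in a disc \<open>B\<close> are in bijection with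
  the zeros of \<open>f\<close> in \<open>\<psi>\<^sup>n(B)\<close>. The scalar multiples of \<open>T\<^sup>n f\<close> approximate functions with any prescribed
  number \<open>N\<close> of simple zeros in \<open>B\<close>, so \<open>f\<close> has at least \<open>N\<close> zeros in some \<open>\<psi>\<^sup>n(B)\<close> with \<open>n = n(N)\<close>.
  If infinitely many of these images \<open>\<psi>\<^sup>n(B)\<close> lay in one compact subset of \<open>\<Omega>\<close>, then \<open>f\<close>
  would have infinitely many zeros there and vanish identically (\<open>no_disc_returns\<close>). It remains to
  show that every sequence of iterates has infinitely many terms that map \<open>B\<close> into one compact set.

  For this a normal family argument is used. If a locally uniform limit of iterates takes only values in
  \<open>\<Omega>\<close>, the compact set is found around the image of \<open>B\<close>. Otherwise, by Hurwitz, the limit is a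
  constant outside \<open>\<Omega>\<close>, possibly infinity, and homology excludes it.
  When there are two holes, \<open>\<Omega>\<close> omits two values, so that Montel's theorem in the form of Schottky and
  Picard applies. A loop close to a point outside \<open>\<Omega>\<close>, or close to infinity, can only wind around one
  connected piece of the complement, or around all holes equally often. Two homologically independent loops
  (\<open>independent_loops\<close>) therefore have a nontrivial integer combination whose image is null-homologous,
  which contradicts injectivity on homology.
  For a domain equivalent to an annulus, the limit is taken after transport to the annulus, where the
  iterates are bounded. A constant limit \<open>c\<close> then has modulus at least 1, so a loop near \<open>c\<close> does not
  wind around the hole, and the image of a generator of the homology under some iterate would be null.
  In a punctured disc \<open>c\<close> could be the puncture, and loops near it need not be null.
\<close>

section \<open>Projectively dense orbits\<close>

text \<open>The compact-open topology enters the proof only through this form of density, in which closeness is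
  measured by the supremum over one compact set.\<close>
definition orbit_approximates :: "complex set \<Rightarrow> ((complex \<Rightarrow> complex) \<Rightarrow> (complex \<Rightarrow> complex)) \<Rightarrow>
    (complex \<Rightarrow> complex) \<Rightarrow> bool" where
  "orbit_approximates \<Omega> T f \<longleftrightarrow>
     (\<forall>g\<in>hol_space \<Omega>. \<forall>K e. compact K \<longrightarrow> K \<subseteq> \<Omega> \<longrightarrow> 0 < e \<longrightarrow>
        (\<exists>c n. \<forall>z\<in>K. cmod (c * (T ^^ n) f z - g z) < e))"

text \<open>By uniform continuity, \<open>K\<close> splits into finitely many compact pieces on which \<open>g\<close> varies by less than
  \<open>e / 2\<close>. Asking that each piece be mapped close to the value of \<open>g\<close> at one of its points is a finite
  intersection of subbasic open conditions.\<close>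
lemma hol_topology_uniform_neighbourhood:
  assumes g: "g \<in> hol_space \<Omega>" and K: "compact K" "K \<subseteq> \<Omega>" and e: "0 < e"
  obtains W where "openin (hol_topology \<Omega>) W" "g \<in> W"
    "\<And>h z. h \<in> W \<Longrightarrow> z \<in> K \<Longrightarrow> cmod (h z - g z) < e"
proof -
  have contg: "continuous_on K g"
    using g K holomorphic_on_imp_continuous_on holomorphic_on_subset
    unfolding hol_space_def by blast
  then have "\<forall>e>0. \<exists>d>0. \<forall>x\<in>K. \<forall>y\<in>K. dist y x < d \<longrightarrow> dist (g y) (g x) < e"
    using K(1) compact_uniformly_continuous unfolding uniformly_continuous_on_def by blast
  from this[rule_format, OF half_gt_zero[OF e]]
  obtain d where d: "d > 0" and
    dg: "\<And>x y. x \<in> K \<Longrightarrow> y \<in> K \<Longrightarrow> dist y x < d \<Longrightarrow> dist (g y) (g x) < e / 2"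
    by auto
  have "\<exists>X. finite X \<and> X \<subseteq> K \<and> K \<subseteq> (\<Union>x\<in>X. ball x (d/2))"
    using seq_compact_imp_totally_bounded[OF compact_imp_seq_compact[OF K(1)]] half_gt_zero[OF d]
    by blast
  then obtain X where X: "finite X" "X \<subseteq> K" "K \<subseteq> (\<Union>x\<in>X. ball x (d/2))"
    by blast
  define V where "V L U = {f \<in> hol_space \<Omega>. f ` L \<subseteq> U}" for L U :: "complex set"
  define W where "W = V {} UNIV \<inter> (\<Inter>x\<in>X. V (K \<inter> cball x (d/2)) (ball (g x) (e/2)))"
  have V_open: "openin (hol_topology \<Omega>) (V L U)" if "compact L" "L \<subseteq> \<Omega>" "open U" for L U
    unfolding hol_topology_def V_def using that
    by (intro topology_generated_by_Basis) blast
  have "openin (hol_topology \<Omega>) W"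
  proof (cases "X = {}")
    case True
    then show ?thesis
      using V_open[of "{}" UNIV] by (simp add: W_def)
  next
    case False
    have "openin (hol_topology \<Omega>) (\<Inter>x\<in>X. V (K \<inter> cball x (d/2)) (ball (g x) (e/2)))"
      using K by (intro openin_INT2 X False V_open compact_Int) auto
    then show ?thesis
      unfolding W_def by (intro openin_Int V_open) auto
  qed
  moreover have "g \<in> W"
  proof -
    have "g ` (K \<inter> cball x (d/2)) \<subseteq> ball (g x) (e/2)" if "x \<in> X" for x
      using dg[of x] that X d by (force simp: dist_commute)
    then show ?thesis
      using g by (auto simp: W_def V_def)
  qed
  moreover have "cmod (h z - g z) < e" if h: "h \<in> W" and z: "z \<in> K" for h z
  proof -
    obtain x where x: "x \<in> X" "dist x z < d/2"
      using X(3) z by auto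
    have "h z \<in> ball (g x) (e/2)"
      using h x z unfolding W_def V_def by force
    moreover have "dist (g z) (g x) < e/2"
      using dg[of x z] x z X d by (auto simp: dist_commute)
    ultimately have "dist (h z) (g z) < e"
      by (metis dist_commute dist_triangle_half_r mem_ball)
    then show ?thesis
      by (simp add: dist_norm)
  qed
  ultimately show ?thesis
    by (rule that)
qed

lemma supercyclic_imp_orbit_approximates:
  assumes "supercyclic_on fun_scale (hol_topology \<Omega>) T"
  obtains f where "f \<in> hol_space \<Omega>" "orbit_approximates \<Omega> T f"
proof -
  obtain f where f: "f \<in> hol_space \<Omega>" and
    dense: "hol_topology \<Omega> closure_of {fun_scale c ((T ^^ n) f) | c n. True} = hol_space \<Omega>"
    using assms by (auto simp: supercyclic_on_def)
  have "\<exists>c n. \<forall>z\<in>K. cmod (c * (T ^^ n) f z - g z) < e"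
    if g: "g \<in> hol_space \<Omega>" and K: "compact K" "K \<subseteq> \<Omega>" and e: "0 < e" for g K e
  proof -
    obtain W where W: "openin (hol_topology \<Omega>) W" "g \<in> W"
      "\<And>h z. h \<in> W \<Longrightarrow> z \<in> K \<Longrightarrow> cmod (h z - g z) < e"
      using hol_topology_uniform_neighbourhood[OF g K e] by blast
    have "g \<in> hol_topology \<Omega> closure_of {fun_scale c ((T ^^ n) f) | c n. True}"
      using g dense by simp
    then obtain h where "h \<in> {fun_scale c ((T ^^ n) f) | c n. True}" "h \<in> W"
      using W(1,2) unfolding in_closure_of by blast
    then show ?thesis
      using W(3) by (fastforce simp: fun_scale_def)
  qed
  then have "orbit_approximates \<Omega> T f"
    unfolding orbit_approximates_def by simp
  then show ?thesis
    using that f by simp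
qed

text \<open>Linearity is required on the holomorphic functions only, and continuity is the estimate by a seminorm
  \<open>sup\<^sub>K |F|\<close> that it amounts to in the compact-open topology.\<close>
definition continuous_functional :: "complex set \<Rightarrow> ((complex \<Rightarrow> complex) \<Rightarrow> complex) \<Rightarrow> bool" where
  "continuous_functional \<Omega> \<Lambda> \<longleftrightarrow>
     (\<forall>F\<in>hol_space \<Omega>. \<forall>G\<in>hol_space \<Omega>. \<forall>a b. \<Lambda> (\<lambda>z. a * F z + b * G z) = a * \<Lambda> F + b * \<Lambda> G) \<and>
     (\<exists>K C. compact K \<and> K \<subseteq> \<Omega> \<and> 0 \<le> C \<and>
        (\<forall>F\<in>hol_space \<Omega>. \<forall>B. (\<forall>z\<in>K. cmod (F z) \<le> B) \<longrightarrow> cmod (\<Lambda> F) \<le> C * B))"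

lemma hol_space_comb:
  assumes "F \<in> hol_space \<Omega>" "G \<in> hol_space \<Omega>"
  shows "(\<lambda>z. a * F z + b * G z) \<in> hol_space \<Omega>"
  using assms by (auto simp: hol_space_def intro!: holomorphic_intros)

text \<open>If \<open>\<Lambda> F \<noteq> 0\<close>, then the elements of the affine hyperplane \<open>\<Lambda> = \<Lambda> F\<close> can only be approximated
  by multiples of the finitely many \<open>T\<^sup>n f\<close> with \<open>n < n0\<close>. Along each of these lines the
  ratio of the value at a point \<open>z1\<close> to the value of \<open>\<Lambda>\<close> is constant, whereas on the hyperplane it takes
  infinitely many values.\<close>
lemma functional_vanishing_on_tail:
  assumes \<Omega>: "open \<Omega>" "\<Omega> \<noteq> {}"
    and orbit: "\<And>n. (T ^^ n) f \<in> hol_space \<Omega>"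
    and dense: "orbit_approximates \<Omega> T f"
    and \<Lambda>: "continuous_functional \<Omega> \<Lambda>"
    and tail: "\<And>n. n \<ge> n0 \<Longrightarrow> \<Lambda> ((T ^^ n) f) = 0"
    and F: "F \<in> hol_space \<Omega>"
  shows "\<Lambda> F = 0"
proof (rule ccontr)
  assume nz: "\<Lambda> F \<noteq> 0"
  define u where "u n = (T ^^ n) f" for n
  have u: "u n \<in> hol_space \<Omega>" for n
    using orbit by (simp add: u_def)
  have lin: "\<Lambda> (\<lambda>z. a * P z + b * Q z) = a * \<Lambda> P + b * \<Lambda> Q"
    if "P \<in> hol_space \<Omega>" "Q \<in> hol_space \<Omega>" for P Q a b
    using \<Lambda> that unfolding continuous_functional_def by blast
  obtain K C where K: "compact K" "K \<subseteq> \<Omega>" and C: "0 \<le> C" and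
    bound: "\<And>P B. P \<in> hol_space \<Omega> \<Longrightarrow> (\<And>z. z \<in> K \<Longrightarrow> cmod (P z) \<le> B) \<Longrightarrow> cmod (\<Lambda> P) \<le> C * B"
    using \<Lambda> unfolding continuous_functional_def by metis
  \<comment> \<open>The kernel contains \<open>F\<close> times a linear polynomial, which is not identically zero.\<close>
  define F2 where "F2 z = z * F z" for z
  have F2: "F2 \<in> hol_space \<Omega>"
    using F by (auto simp: hol_space_def F2_def[abs_def] intro!: holomorphic_intros)
  define k where "k z = \<Lambda> F * F2 z + (- \<Lambda> F2) * F z" for z
  have k: "k \<in> hol_space \<Omega>" "\<Lambda> k = 0"
    using hol_space_comb[OF F2 F, of "\<Lambda> F" "- \<Lambda> F2"] lin[OF F2 F, of "\<Lambda> F" "- \<Lambda> F2"]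
    unfolding k_def[abs_def, symmetric] by auto
  have "\<exists>z\<in>\<Omega>. F z \<noteq> 0"
  proof (rule ccontr)
    assume "\<not> (\<exists>z\<in>\<Omega>. F z \<noteq> 0)"
    then have "cmod (\<Lambda> F) \<le> C * 0"
      using K by (intro bound F) auto
    then show False using nz by simp
  qed
  moreover have "open {z \<in> \<Omega>. F z \<noteq> 0}"
  proof -
    have "continuous_on \<Omega> F"
      using F by (auto simp: hol_space_def intro: holomorphic_on_imp_continuous_on)
    then have "open (\<Omega> \<inter> F -` (- {0}))"
      using \<Omega>(1) continuous_open_preimage by blast
    also have "\<Omega> \<inter> F -` (- {0}) = {z \<in> \<Omega>. F z \<noteq> 0}" by auto
    finally show ?thesis .
  qed
  ultimately have "infinite {z \<in> \<Omega>. F z \<noteq> 0}"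
    using finite_imp_not_open[of "{z \<in> \<Omega>. F z \<noteq> 0}"] by blast
  then have "\<not> {z \<in> \<Omega>. F z \<noteq> 0} \<subseteq> {\<Lambda> F2 / \<Lambda> F}"
    using finite_subset by blast
  then obtain z1 where z1: "z1 \<in> \<Omega>" "F z1 \<noteq> 0" "z1 \<noteq> \<Lambda> F2 / \<Lambda> F"
    by blast
  have kz1: "k z1 \<noteq> 0"
  proof
    assume "k z1 = 0"
    then have "(\<Lambda> F * z1 - \<Lambda> F2) * F z1 = 0"
      by (simp add: k_def F2_def algebra_simps)
    then show False
      using z1 nz by (auto simp: field_simps)
  qed
  \<comment> \<open>Choose \<open>t\<close> so that the ratio at \<open>F + t k\<close> differs from the ratios along the first \<open>n0\<close> orbit lines.\<close>
  define R where "R = (\<lambda>n. u n z1 / \<Lambda> (u n)) ` {..<n0}"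
  have finR: "finite R"
    by (simp add: R_def)
  have "finite ((\<lambda>r. (r * \<Lambda> F - F z1) / k z1) ` R)"
    using finR by simp
  then obtain t where t: "t \<notin> (\<lambda>r. (r * \<Lambda> F - F z1) / k z1) ` R"
    using ex_new_if_finite infinite_UNIV_char_0 by blast
  define G where "G z = 1 * F z + t * k z" for z
  have G: "G \<in> hol_space \<Omega>" "\<Lambda> G = \<Lambda> F"
    using hol_space_comb[OF F k(1), of 1 t] lin[OF F k(1), of 1 t] k(2)
    unfolding G_def[abs_def, symmetric] by auto
  have G_ratio: "0 < cmod (G z1 - r * \<Lambda> F)" if "r \<in> R" for r
  proof -
    have "t \<noteq> (r * \<Lambda> F - F z1) / k z1"
      using t that by blast
    then show ?thesis
      using kz1 by (auto simp: G_def field_simps)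
  qed
  have "\<forall>\<^sub>F e in at_right 0. C * e < cmod (\<Lambda> F)"
  proof -
    have "((\<lambda>e. C * e) \<longlongrightarrow> C * 0) (at_right 0)"
      by (intro tendsto_intros)
    then show ?thesis
      by (rule order_tendstoD) (use nz in simp)
  qed
  moreover have "\<forall>\<^sub>F e in at_right 0. \<forall>r\<in>R. e + cmod r * (C * e) < cmod (G z1 - r * \<Lambda> F)"
  proof (intro eventually_ball_finite finR ballI)
    fix r assume r: "r \<in> R"
    have "((\<lambda>e. e + cmod r * (C * e)) \<longlongrightarrow> 0 + cmod r * (C * 0)) (at_right 0)"
      by (intro tendsto_intros)
    then show "\<forall>\<^sub>F e in at_right 0. e + cmod r * (C * e) < cmod (G z1 - r * \<Lambda> F)"
      by (rule order_tendstoD) (use G_ratio[OF r] in simp)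
  qed
  moreover have "\<forall>\<^sub>F e in at_right (0::real). 0 < e"
    by (simp add: eventually_at_right_less)
  ultimately have "\<forall>\<^sub>F e in at_right 0. C * e < cmod (\<Lambda> F) \<and> 0 < e \<and>
      (\<forall>r\<in>R. e + cmod r * (C * e) < cmod (G z1 - r * \<Lambda> F))"
    by eventually_elim auto
  then obtain e where e: "C * e < cmod (\<Lambda> F)" "0 < e"
      "\<And>r. r \<in> R \<Longrightarrow> e + cmod r * (C * e) < cmod (G z1 - r * \<Lambda> F)"
    using eventually_happens'[OF trivial_limit_at_right_real] by blast
  have "compact (insert z1 K)" "insert z1 K \<subseteq> \<Omega>"
    using K z1 by auto
  then obtain c n where approx: "\<And>z. z \<in> insert z1 K \<Longrightarrow> cmod (c * u n z - G z) < e"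
    using dense G(1) e(2) unfolding orbit_approximates_def u_def by meson
  define D where "D z = c * u n z + (-1) * G z" for z
  have "D \<in> hol_space \<Omega>" and \<Lambda>D: "\<Lambda> D = c * \<Lambda> (u n) - \<Lambda> F"
    using hol_space_comb[OF u[of n] G(1), of c "-1"] lin[OF u[of n] G(1), of c "-1"] G(2)
    unfolding D_def[abs_def, symmetric] by auto
  then have \<Lambda>close: "cmod (c * \<Lambda> (u n) - \<Lambda> F) \<le> C * e"
    using bound[of D e] approx by (force simp: D_def)
  then have cu: "c * \<Lambda> (u n) \<noteq> 0"
    using e(1) by auto
  then have "n < n0"
    using tail[of n] by (auto simp: u_def not_le[symmetric])
  define r where "r = u n z1 / \<Lambda> (u n)"
  have r: "r \<in> R"
    using \<open>n < n0\<close> by (auto simp: R_def r_def)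
  have "G z1 - r * \<Lambda> F = r * (c * \<Lambda> (u n) - \<Lambda> F) - (c * u n z1 - G z1)"
    using cu by (simp add: r_def field_simps)
  then have "cmod (G z1 - r * \<Lambda> F) \<le> cmod r * cmod (c * \<Lambda> (u n) - \<Lambda> F) + cmod (c * u n z1 - G z1)"
    by (metis norm_mult norm_triangle_ineq4)
  also have "\<dots> \<le> cmod r * (C * e) + e"
    using \<Lambda>close approx[of z1] by (intro add_mono mult_left_mono) auto
  finally show False
    using e(3)[OF r] by simp
qed

section \<open>Loops and functionals given by integration\<close>

definition loop_in :: "complex set \<Rightarrow> (real \<Rightarrow> complex) \<Rightarrow> bool" where
  "loop_in S \<gamma> \<longleftrightarrow> valid_path \<gamma> \<and> pathfinish \<gamma> = pathstart \<gamma> \<and> path_image \<gamma> \<subseteq> S"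

text \<open>For a loop in an open set \<open>S\<close> this is equivalent, by Cauchy's theorem and the functions
  \<open>1 / (z - w)\<close>, to winding number zero around every point outside \<open>S\<close>. Stated with integrals it is
  directly accessible to continuous functionals.\<close>
definition null_loop :: "complex set \<Rightarrow> (real \<Rightarrow> complex) \<Rightarrow> bool" where
  "null_loop S \<gamma> \<longleftrightarrow> (\<forall>g. g holomorphic_on S \<longrightarrow> contour_integral \<gamma> g = 0)"

lemma loop_in_compose:
  assumes "loop_in S \<gamma>" "h holomorphic_on S" "open S" "h ` S \<subseteq> T"
  shows "loop_in T (h \<circ> \<gamma>)"
  using assms valid_path_compose_holomorphic[of \<gamma> h S]
  by (auto simp: loop_in_def path_image_compose pathfinish_compose pathstart_compose)

lemma contour_integral_compose:
  assumes "loop_in S \<gamma>" "h holomorphic_on S" "open S"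
  shows "contour_integral (h \<circ> \<gamma>) g = contour_integral \<gamma> (\<lambda>w. deriv h w * g (h w))"
  using assms by (intro contour_integral_comp_analyticW[of h S]) (auto simp: loop_in_def analytic_on_open)

lemma loop_integrable:
  assumes "loop_in S \<gamma>" "g holomorphic_on S" "open S"
  shows "g contour_integrable_on \<gamma>"
  using assms contour_integrable_holomorphic_simple by (auto simp: loop_in_def)

lemma continuous_functional_evaluation:
  assumes "x \<in> \<Omega>" "y \<in> \<Omega>"
  shows "continuous_functional \<Omega> (\<lambda>F. a * F x + b * F y)"
  unfolding continuous_functional_def
proof (intro conjI exI ballI allI impI)
  show "compact {x, y}" "{x, y} \<subseteq> \<Omega>" using assms by auto
  show "0 \<le> cmod a + cmod b" by simp
  fix F :: "complex \<Rightarrow> complex" and B assume "\<forall>z\<in>{x, y}. cmod (F z) \<le> B"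
  then have "cmod a * cmod (F x) \<le> cmod a * B" "cmod b * cmod (F y) \<le> cmod b * B"
    by (auto intro!: mult_left_mono)
  then have "cmod (a * F x) + cmod (b * F y) \<le> (cmod a + cmod b) * B"
    by (simp add: norm_mult distrib_right)
  then show "cmod (a * F x + b * F y) \<le> (cmod a + cmod b) * B"
    using norm_triangle_ineq order_trans by blast
qed (simp add: algebra_simps)

text \<open>The bound of an integral by a supremum over an open set is turned into one over a compact set by
  thickening the image of the path within \<open>\<Omega>\<close>.\<close>
lemma continuous_functional_loop:
  assumes \<Omega>: "open \<Omega>" and \<gamma>: "loop_in \<Omega> \<gamma>" and q: "q holomorphic_on \<Omega>"
  shows "continuous_functional \<Omega> (\<lambda>F. contour_integral \<gamma> (\<lambda>z. F z * q z))"
proof -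
  have comp: "compact (path_image \<gamma>)" and sub: "path_image \<gamma> \<subseteq> \<Omega>" and vp: "valid_path \<gamma>"
    using \<gamma> by (auto simp: loop_in_def compact_valid_path_image)
  obtain e where e: "e > 0" "(\<Union>x\<in>path_image \<gamma>. cball x e) \<subseteq> \<Omega>"
    using compact_subset_open_imp_cball_epsilon_subset[OF comp \<Omega> sub] by blast
  define K where "K = (\<Union>x\<in>path_image \<gamma>. cball x e)"
  define U where "U = (\<Union>x\<in>path_image \<gamma>. ball x e)"
  have K: "compact K" "K \<subseteq> \<Omega>" and U: "open U" "path_image \<gamma> \<subseteq> U" "U \<subseteq> K"
    using compact_minkowski_sum_cball[OF comp, of e] e by (auto simp: K_def U_def)
  obtain L where L: "L > 0" "\<And>h B. h holomorphic_on U \<Longrightarrow> (\<forall>z\<in>U. cmod (h z) \<le> B) \<Longrightarrow>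
      cmod (contour_integral \<gamma> h) \<le> L * B"
    using contour_integral_bound_exists[OF U(1) vp U(2)] by blast
  have "continuous_on K q"
    using q K(2) holomorphic_on_imp_continuous_on continuous_on_subset by blast
  then obtain Q where Q: "Q \<ge> 0" "\<And>z. z \<in> K \<Longrightarrow> cmod (q z) \<le> Q"
    using continuous_on_compact_bound[OF K(1)] by blast
  have hol: "(\<lambda>z. F z * q z) holomorphic_on \<Omega>" if "F \<in> hol_space \<Omega>" for F
    using that q by (auto simp: hol_space_def intro!: holomorphic_intros)
  show ?thesis
    unfolding continuous_functional_def
  proof (intro conjI exI ballI allI impI)
    fix F G a b assume FG: "F \<in> hol_space \<Omega>" "G \<in> hol_space \<Omega>"
    have "(\<lambda>z. F z * q z) contour_integrable_on \<gamma>" "(\<lambda>z. G z * q z) contour_integrable_on \<gamma>"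
      using loop_integrable[OF \<gamma> hol \<Omega>] FG by auto
    then have "contour_integral \<gamma> (\<lambda>z. a * (F z * q z) + b * (G z * q z)) =
        a * contour_integral \<gamma> (\<lambda>z. F z * q z) + b * contour_integral \<gamma> (\<lambda>z. G z * q z)"
      by (simp add: contour_integral_add contour_integral_lmul contour_integrable_lmul)
    then show "contour_integral \<gamma> (\<lambda>z. (a * F z + b * G z) * q z) =
        a * contour_integral \<gamma> (\<lambda>z. F z * q z) + b * contour_integral \<gamma> (\<lambda>z. G z * q z)"
      by (simp add: algebra_simps)
  next
    show "compact K" "K \<subseteq> \<Omega>" "0 \<le> L * Q"
      using K L(1) Q(1) by auto
    fix F B assume F: "F \<in> hol_space \<Omega>" and B: "\<forall>z\<in>K. cmod (F z) \<le> B"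
    have "cmod (contour_integral \<gamma> (\<lambda>z. F z * q z)) \<le> L * (B * Q)"
    proof (rule L(2))
      show "(\<lambda>z. F z * q z) holomorphic_on U"
        using hol[OF F] holomorphic_on_subset U(3) K(2) by blast
      show "\<forall>z\<in>U. cmod (F z * q z) \<le> B * Q"
      proof
        fix z assume "z \<in> U"
        then have "cmod (F z) \<le> B" "cmod (q z) \<le> Q"
          using U(3) B Q(2) by auto
        then show "cmod (F z * q z) \<le> B * Q"
          unfolding norm_mult by (intro mult_mono) (use norm_ge_zero order_trans in blast)+
      qed
    qed
    then show "cmod (contour_integral \<gamma> (\<lambda>z. F z * q z)) \<le> L * Q * B"
      by (simp add: mult_ac)
  qed
qed

definition restrict_to :: "complex set \<Rightarrow> (complex \<Rightarrow> complex) \<Rightarrow> (complex \<Rightarrow> complex)" where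
  "restrict_to S g = (\<lambda>z. if z \<in> S then g z else 0)"

lemma restrict_to_in_hol_space:
  assumes "g holomorphic_on \<Omega>"
  shows "restrict_to \<Omega> g \<in> hol_space \<Omega>"
proof -
  have "restrict_to \<Omega> g holomorphic_on \<Omega>"
    using assms by (rule holomorphic_transform) (simp add: restrict_to_def)
  then show ?thesis by (simp add: hol_space_def restrict_to_def)
qed

section \<open>Consequences of a supercyclic vector\<close>

locale supercyclic_vector =
  fixes \<Omega> :: "complex set" and \<omega> \<psi> f :: "complex \<Rightarrow> complex"
  assumes open_\<Omega>: "open \<Omega>" and connected_\<Omega>: "connected \<Omega>" and nonempty_\<Omega>: "\<Omega> \<noteq> {}"
    and hol_\<omega>: "\<omega> holomorphic_on \<Omega>" and hol_\<psi>: "\<psi> holomorphic_on \<Omega>" and self: "\<psi> ` \<Omega> \<subseteq> \<Omega>"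
    and f_in: "f \<in> hol_space \<Omega>"
    and dense: "orbit_approximates \<Omega> (weighted_comp \<Omega> \<omega> \<psi>) f"
begin

abbreviation T where "T \<equiv> weighted_comp \<Omega> \<omega> \<psi>"

lemma orbit_in_hol_space: "(T ^^ n) f \<in> hol_space \<Omega>"
  by (induction n) (auto simp: f_in intro: weighted_comp_in_hol_space[OF hol_\<omega> hol_\<psi> self])

lemma orbit_Suc: "z \<in> \<Omega> \<Longrightarrow> (T ^^ Suc n) f z = \<omega> z * (T ^^ n) f (\<psi> z)"
  by (simp add: weighted_comp_def)

text \<open>A dual form of the fact that the operator has dense range.\<close>
lemma functional_vanishing_on_range:
  assumes "continuous_functional \<Omega> \<Lambda>" "\<And>n. \<Lambda> ((T ^^ Suc n) f) = 0" "F \<in> hol_space \<Omega>"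
  shows "\<Lambda> F = 0"
proof (rule functional_vanishing_on_tail[OF open_\<Omega> nonempty_\<Omega> orbit_in_hol_space dense assms(1)])
  show "\<Lambda> ((T ^^ n) f) = 0" if "n \<ge> 1" for n
    using assms(2)[of "n - 1"] that by simp
qed (rule assms(3))

lemma evaluation_relation_on_range:
  assumes x: "x \<in> \<Omega>" and y: "y \<in> \<Omega>" and g: "g holomorphic_on \<Omega>"
    and range: "\<And>n. a * (T ^^ Suc n) f x + b * (T ^^ Suc n) f y = 0"
  shows "a * g x + b * g y = 0"
  using functional_vanishing_on_range[OF continuous_functional_evaluation[OF x y]
      range restrict_to_in_hol_space[OF g]] x y
  by (simp add: restrict_to_def)

lemma weight_nonzero:
  assumes a: "a \<in> \<Omega>"
  shows "\<omega> a \<noteq> 0"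
proof
  assume 0: "\<omega> a = 0"
  have "1 * 1 + 0 * 1 = (0 :: complex)"
    by (rule evaluation_relation_on_range[OF a a, of "\<lambda>_. 1"])
      (auto simp: orbit_Suc[OF a] 0 simp del: funpow.simps)
  then show False by simp
qed

text \<open>If \<open>\<psi> a = \<psi> b\<close>, every function \<open>F\<close> in the range of the operator satisfies
  \<open>\<omega> b \<cdot> F a = \<omega> a \<cdot> F b\<close>, hence every holomorphic function does. The constant 1 and the identity
  show that \<open>a = b\<close>.\<close>
lemma selfmap_inj: "inj_on \<psi> \<Omega>"
proof (rule inj_onI)
  fix a b assume a: "a \<in> \<Omega>" and b: "b \<in> \<Omega>" and eq: "\<psi> a = \<psi> b"
  have *: "\<omega> b * g a + (- \<omega> a) * g b = 0" if "g holomorphic_on \<Omega>" for g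
    by (rule evaluation_relation_on_range[OF a b that])
      (simp add: orbit_Suc[OF a] orbit_Suc[OF b] eq del: funpow.simps)
  have "\<omega> a = \<omega> b"
    using *[of "\<lambda>z. 1"] by simp
  moreover have "\<omega> b * a = \<omega> a * b"
    using *[of "\<lambda>z. z"] by simp
  ultimately show "a = b"
    using weight_nonzero[OF a] by simp
qed

lemma iterate_holomorphic: "(\<psi> ^^ n) holomorphic_on \<Omega>"
  and iterate_self: "(\<psi> ^^ n) ` \<Omega> \<subseteq> \<Omega>"
  and iterate_inj: "inj_on (\<psi> ^^ n) \<Omega>"
proof (induction n)
  case (Suc n)
  show 1: "(\<psi> ^^ Suc n) holomorphic_on \<Omega>"
    unfolding funpow.simps using Suc holomorphic_on_compose_gen hol_\<psi> by blast
  show "(\<psi> ^^ Suc n) ` \<Omega> \<subseteq> \<Omega>"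
    using Suc(2) self by auto
  show "inj_on (\<psi> ^^ Suc n) \<Omega>"
    unfolding funpow.simps
    by (intro comp_inj_on Suc(3) inj_on_subset[OF selfmap_inj] Suc(2))
qed (auto simp: id_def)

lemma orbit_eq_0_iff: "z \<in> \<Omega> \<Longrightarrow> (T ^^ n) f z = 0 \<longleftrightarrow> f ((\<psi> ^^ n) z) = 0"
proof (induction n arbitrary: z)
  case (Suc n)
  then have "\<psi> z \<in> \<Omega>" using self by blast
  then show ?case
    using orbit_Suc[OF Suc.prems, of n] weight_nonzero[OF Suc.prems] Suc.IH[of "\<psi> z"]
    by (simp add: funpow_Suc_right del: funpow.simps)
qed simp

lemma f_nonzero: "\<exists>z\<in>\<Omega>. f z \<noteq> 0"
proof (rule ccontr)
  assume "\<not> ?thesis"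
  moreover obtain a where a: "a \<in> \<Omega>" using nonempty_\<Omega> by blast
  ultimately have 0: "(T ^^ n) f a = 0" for n
    using orbit_eq_0_iff[OF a] iterate_self[of n] by blast
  have "1 * 1 + 0 * 1 = (0 :: complex)"
    by (rule evaluation_relation_on_range[OF a a, of "\<lambda>_. 1"]) (auto simp: 0 simp del: funpow.simps)
  then show False by simp
qed

text \<open>Substitution gives \<open>\<integral>\<^sub>\<gamma> (T F) \<psi>' / \<omega> = \<integral>\<^sub>\<gamma> (F \<circ> \<psi>) \<psi>' = \<integral>\<^bsub>\<psi> \<circ> \<gamma>\<^esub> F = 0\<close>. So the functional
  \<open>F \<mapsto> \<integral>\<^sub>\<gamma> F \<psi>' / \<omega>\<close> is zero, and since neither \<open>\<omega>\<close> nor \<open>\<psi>'\<close> has zeros, every holomorphic \<open>g\<close> has the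
  form \<open>F \<psi>' / \<omega>\<close>.\<close>
lemma null_loop_pullback:
  assumes \<gamma>: "loop_in \<Omega> \<gamma>" and null: "null_loop \<Omega> (\<psi> \<circ> \<gamma>)"
  shows "null_loop \<Omega> \<gamma>"
  unfolding null_loop_def
proof (intro allI impI)
  fix g assume g: "g holomorphic_on \<Omega>"
  have regular: "deriv \<psi> z \<noteq> 0" if "z \<in> \<Omega>" for z
    using holomorphic_injective_imp_regular[OF hol_\<psi> open_\<Omega> selfmap_inj that] .
  define q where "q = (\<lambda>z. deriv \<psi> z / \<omega> z)"
  have q: "q holomorphic_on \<Omega>"
    unfolding q_def using weight_nonzero
    by (intro holomorphic_intros hol_\<omega> holomorphic_deriv[OF hol_\<psi> open_\<Omega>])
  have sub: "path_image \<gamma> \<subseteq> \<Omega>"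
    using \<gamma> by (simp add: loop_in_def)
  have "contour_integral \<gamma> (\<lambda>z. (T ^^ Suc n) f z * q z) = 0" for n
  proof -
    have "contour_integral \<gamma> (\<lambda>z. (T ^^ Suc n) f z * q z) =
        contour_integral \<gamma> (\<lambda>z. deriv \<psi> z * (T ^^ n) f (\<psi> z))"
      using sub weight_nonzero
      by (intro contour_integral_cong refl) (auto simp: orbit_Suc q_def simp del: funpow.simps)
    also have "\<dots> = contour_integral (\<psi> \<circ> \<gamma>) ((T ^^ n) f)"
      by (rule contour_integral_compose[OF \<gamma> hol_\<psi> open_\<Omega>, symmetric])
    also have "\<dots> = 0"
      using null orbit_in_hol_space[of n] by (simp add: null_loop_def hol_space_def)
    finally show ?thesis .
  qed
  moreover have h: "(\<lambda>z. g z * \<omega> z / deriv \<psi> z) holomorphic_on \<Omega>"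
    using regular by (intro holomorphic_intros g hol_\<omega> holomorphic_deriv[OF hol_\<psi> open_\<Omega>])
  ultimately have "contour_integral \<gamma>
      (\<lambda>z. restrict_to \<Omega> (\<lambda>z. g z * \<omega> z / deriv \<psi> z) z * q z) = 0"
    using functional_vanishing_on_range[OF continuous_functional_loop[OF open_\<Omega> \<gamma> q]]
      restrict_to_in_hol_space[OF h] by blast
  moreover have "contour_integral \<gamma> (\<lambda>z. restrict_to \<Omega> (\<lambda>z. g z * \<omega> z / deriv \<psi> z) z * q z) =
      contour_integral \<gamma> g"
    using sub weight_nonzero regular
    by (intro contour_integral_cong refl) (auto simp: restrict_to_def q_def subset_iff)
  ultimately show "contour_integral \<gamma> g = 0" by simp
qed

lemma null_loop_iterate_pullback:
  "loop_in \<Omega> \<gamma> \<Longrightarrow> null_loop \<Omega> ((\<psi> ^^ n) \<circ> \<gamma>) \<Longrightarrow> null_loop \<Omega> \<gamma>"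
proof (induction n)
  case (Suc n)
  have "loop_in \<Omega> ((\<psi> ^^ n) \<circ> \<gamma>)"
    by (rule loop_in_compose[OF Suc.prems(1) iterate_holomorphic open_\<Omega> iterate_self])
  moreover have "null_loop \<Omega> (\<psi> \<circ> ((\<psi> ^^ n) \<circ> \<gamma>))"
    using Suc.prems(2) by (simp add: comp_def)
  ultimately show ?case
    using null_loop_pullback Suc by blast
qed simp

text \<open>The polynomial \<open>g\<close> with \<open>N\<close> equally spaced zeros \<open>a i\<close> on a radius of the disc is approximated by a
  multiple of \<open>T\<^sup>n f\<close>. On the circle of radius \<open>\<rho>\<close> around \<open>a i\<close> every factor of \<open>g\<close> has modulus at
  least \<open>\<rho>\<close>, so an approximation within \<open>\<rho>\<^sup>N / 2\<close> is smaller at \<open>a i\<close> than anywhere on that circle and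
  has a zero inside it by the maximum principle.\<close>
lemma orbit_with_many_zeros:
  assumes R: "R > 0" and disc: "cball z0 R \<subseteq> \<Omega>"
  obtains n Z where "finite Z" "card Z = N" "Z \<subseteq> (\<psi> ^^ n) ` cball z0 R" "\<And>z. z \<in> Z \<Longrightarrow> f z = 0"
proof -
  define \<rho> where "\<rho> = R / (4 * (real N + 1))"
  define a where "a i = z0 + of_real (4 * \<rho> * real i)" for i
  define g where "g z = (\<Prod>i<N. z - a i)" for z
  have \<rho>: "\<rho> > 0" using R by (simp add: \<rho>_def)
  have sep: "cmod (a i - a k) \<ge> 4 * \<rho>" if "i \<noteq> k" for i k
  proof -
    have "cmod (a i - a k) = \<bar>4 * \<rho> * (real i - real k)\<bar>"
      unfolding a_def by (simp add: algebra_simps flip: of_real_diff of_real_mult)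
    also have "\<dots> = 4 * \<rho> * \<bar>real i - real k\<bar>"
      using \<rho> by (simp add: abs_mult)
    also have "\<dots> \<ge> 4 * \<rho> * 1"
      using \<rho> that by (intro mult_left_mono) auto
    finally show ?thesis by simp
  qed
  have inside: "cball (a i) \<rho> \<subseteq> cball z0 R" if "i < N" for i
  proof -
    have "dist z0 (a i) + \<rho> = \<rho> * (4 * real i + 1)"
      using \<rho> by (simp add: a_def dist_norm norm_mult algebra_simps)
    also have "\<dots> \<le> \<rho> * (4 * (real N + 1))"
      using \<rho> that by (intro mult_left_mono) auto
    also have "\<dots> = R"
      by (simp add: \<rho>_def)
    finally show ?thesis
      by (simp add: cball_subset_cball_iff dist_commute)
  qed
  have g_hol: "restrict_to \<Omega> g \<in> hol_space \<Omega>"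
    by (rule restrict_to_in_hol_space) (auto simp: g_def[abs_def] intro!: holomorphic_intros)
  define e where "e = \<rho> ^ N / 2"
  have e: "e > 0" using \<rho> by (simp add: e_def)
  have g_large: "2 * e \<le> cmod (g z)" if z: "cmod (a i - z) = \<rho>" for i z
  proof -
    have "\<rho> \<le> cmod (z - a k)" for k
    proof (cases "k = i")
      case False
      have "a i - a k = (a i - z) + (z - a k)" by simp
      then have "cmod (a i - a k) \<le> cmod (a i - z) + cmod (z - a k)"
        by (metis norm_triangle_ineq)
      then show ?thesis using sep[of i k] False z \<rho> by simp
    qed (use z in \<open>simp add: norm_minus_commute\<close>)
    then have "(\<Prod>k<N. \<rho>) \<le> (\<Prod>k<N. cmod (z - a k))"
      using \<rho> by (intro prod_mono) auto
    then show ?thesis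
      by (simp add: e_def g_def prod_norm)
  qed
  obtain c n where approx: "\<And>z. z \<in> cball z0 R \<Longrightarrow> cmod (c * (T ^^ n) f z - restrict_to \<Omega> g z) < e"
    using dense g_hol disc e compact_cball[of z0 R] unfolding orbit_approximates_def by meson
  define F where "F z = c * (T ^^ n) f z" for z
  have F_hol: "F holomorphic_on \<Omega>"
    using orbit_in_hol_space[of n] by (auto simp: F_def[abs_def] hol_space_def intro!: holomorphic_intros)
  have F_approx: "cmod (F z - g z) < e" if "z \<in> cball z0 R" for z
    using approx[OF that] that disc by (auto simp: F_def restrict_to_def)
  have "\<exists>z\<in>ball (a i) \<rho>. F z = 0" if i: "i < N" for i
  proof -
    have sub: "cball (a i) \<rho> \<subseteq> \<Omega>"
      using inside[OF i] disc by blast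
    have less: "cmod (F (a i)) < cmod (F z)" if z: "cmod (a i - z) = \<rho>" for z
    proof -
      have "z \<in> cball z0 R" "a i \<in> cball z0 R"
        using inside[OF i] z \<rho> by (auto simp: dist_norm subset_iff)
      have "g (a i) = 0"
        using i unfolding g_def by (intro prod_zero) auto
      then have "cmod (F (a i)) < e"
        using F_approx[OF \<open>a i \<in> _\<close>] by simp
      have "2 * e \<le> cmod (g z)"
        by (rule g_large[OF z])
      moreover have "cmod (g z) \<le> cmod (F z) + cmod (F z - g z)"
        by (metis norm_minus_commute norm_triangle_sub)
      ultimately show ?thesis
        using F_approx[OF \<open>z \<in> _\<close>] \<open>cmod (F (a i)) < e\<close> by linarith
    qed
    have "F holomorphic_on cball (a i) \<rho>"
      using F_hol sub holomorphic_on_subset by blast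
    then have "continuous_on (cball (a i) \<rho>) F" "F holomorphic_on ball (a i) \<rho>"
      using holomorphic_on_imp_continuous_on holomorphic_on_subset ball_subset_cball by blast+
    then obtain z where "z \<in> ball (a i) \<rho>" "F z = 0"
      using holomorphic_contract_to_zero[of "a i" \<rho> F] \<rho> less by metis
    then show ?thesis by blast
  qed
  then obtain z where z: "\<And>i. i < N \<Longrightarrow> z i \<in> ball (a i) \<rho> \<and> F (z i) = 0"
    by metis
  have inj_z: "inj_on z {..<N}"
  proof (rule inj_onI)
    fix i k assume ik: "i \<in> {..<N}" "k \<in> {..<N}" "z i = z k"
    show "i = k"
    proof (rule ccontr)
      assume "i \<noteq> k"
      have "dist (a i) (a k) \<le> dist (a i) (z i) + dist (a k) (z i)"
        by (rule dist_triangle2)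
      then show False
        using sep[OF \<open>i \<noteq> k\<close>] z[of i] z[of k] ik \<rho> by (auto simp: dist_norm)
    qed
  qed
  have z_disc: "z i \<in> cball z0 R" if "i < N" for i
    using z[OF that] inside[OF that] ball_subset_cball by blast
  have "f ((\<psi> ^^ n) (z i)) = 0" if i: "i < N" for i
  proof -
    define w where "w = a i + of_real \<rho>"
    \<comment> \<open>The scalar is nonzero, since \<open>F\<close> has no zeros on the circle around \<open>a i\<close>.\<close>
    have "c \<noteq> 0"
    proof
      assume "c = 0"
      have "w \<in> cball (a i) \<rho>"
        using \<rho> by (simp add: w_def dist_norm)
      then have "w \<in> cball z0 R" using inside[OF i] by blast
      have "2 * e \<le> cmod (g w)"
        using \<rho> by (intro g_large[of i]) (simp add: w_def)
      then show False
        using F_approx[OF \<open>w \<in> cball z0 R\<close>] \<open>c = 0\<close> e by (simp add: F_def)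
    qed
    then show ?thesis
      using z[OF i] z_disc[OF i] disc orbit_eq_0_iff[of "z i" n] by (auto simp: F_def)
  qed
  moreover have "card ((\<lambda>i. (\<psi> ^^ n) (z i)) ` {..<N}) = N"
  proof -
    have "inj_on (\<lambda>i. (\<psi> ^^ n) (z i)) {..<N}"
      using inj_z inj_onD[OF iterate_inj[of n]] z_disc disc
      by (auto simp: inj_on_def subset_iff)
    then show ?thesis by (simp add: card_image)
  qed
  ultimately show ?thesis
    using z_disc by (intro that[of "(\<lambda>i. (\<psi> ^^ n) (z i)) ` {..<N}" n]) auto
qed

text \<open>Take for \<open>s N\<close> an iterate whose image of the disc contains \<open>N\<close> zeros of \<open>f\<close>. A compact set that contains
  infinitely many of these images would contain infinitely many zeros.\<close>
lemma no_disc_returns: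
  assumes R: "R > 0" and disc: "cball z0 R \<subseteq> \<Omega>"
    and return: "\<And>s :: nat \<Rightarrow> nat. \<exists>K. compact K \<and> K \<subseteq> \<Omega> \<and>
                    (\<exists>\<^sub>\<infinity>j. (\<psi> ^^ s j) ` cball z0 R \<subseteq> K)"
  shows False
proof -
  have "\<forall>N. \<exists>n Z. finite Z \<and> card Z = N \<and> Z \<subseteq> (\<psi> ^^ n) ` cball z0 R \<and> (\<forall>z\<in>Z. f z = 0)"
    using orbit_with_many_zeros[OF R disc] by metis
  then obtain s Z where sZ: "\<And>N. finite (Z N)" "\<And>N. card (Z N) = N"
      "\<And>N. Z N \<subseteq> (\<psi> ^^ s N) ` cball z0 R" "\<And>N z. z \<in> Z N \<Longrightarrow> f z = 0"
    by metis
  obtain K where K: "compact K" "K \<subseteq> \<Omega>" and inf: "\<exists>\<^sub>\<infinity>j. (\<psi> ^^ s j) ` cball z0 R \<subseteq> K"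
    using return by blast
  obtain b where b: "b \<in> \<Omega>" "f b \<noteq> 0" using f_nonzero by blast
  have "\<not> f constant_on \<Omega> \<or> (\<forall>z\<in>\<Omega>. f z \<noteq> 0)"
    using b by (metis constant_on_def)
  then have fin: "finite {z \<in> K. f z = 0}"
  proof
    assume "\<not> f constant_on \<Omega>"
    then show ?thesis
      using holomorphic_compact_finite_zeros[OF _ open_\<Omega> connected_\<Omega> K] f_in
      by (simp add: hol_space_def)
  next
    assume "\<forall>z\<in>\<Omega>. f z \<noteq> 0"
    then have "{z \<in> K. f z = 0} \<subseteq> {}" using K(2) by blast
    then show ?thesis by (rule finite_subset) simp
  qed
  obtain j where j: "j > card {z \<in> K. f z = 0}" "(\<psi> ^^ s j) ` cball z0 R \<subseteq> K"
    using inf unfolding INFM_nat by blast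
  have "Z j \<subseteq> {z \<in> K. f z = 0}"
    using sZ(3,4) j(2) by blast
  then have "j \<le> card {z \<in> K. f z = 0}"
    using card_mono[OF fin] sZ(2) by metis
  then show False using j(1) by simp
qed

end

section \<open>Combining loops\<close>

lemma connecting_path:
  assumes "open S" "connected S" "x \<in> S" "y \<in> S"
  obtains \<sigma> :: "real \<Rightarrow> complex" where "valid_path \<sigma>" "path_image \<sigma> \<subseteq> S" "pathstart \<sigma> = x" "pathfinish \<sigma> = y"
  using connected_open_polynomial_connected[OF assms] valid_path_polynomial_function by blast

text \<open>The loop is conjugated by a path from \<open>p\<close> to its starting point.\<close>
lemma loop_rebase:
  assumes S: "open S" "connected S" and \<gamma>: "loop_in S \<gamma>" and p: "p \<in> S"
  obtains \<delta> where "loop_in S \<delta>" "pathstart \<delta> = p"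
    "\<And>g. g holomorphic_on S \<Longrightarrow> contour_integral \<delta> g = contour_integral \<gamma> g"
proof -
  have vp: "valid_path \<gamma>" and cl: "pathfinish \<gamma> = pathstart \<gamma>" and sub: "path_image \<gamma> \<subseteq> S"
    using \<gamma> by (auto simp: loop_in_def)
  then have "pathstart \<gamma> \<in> S" by auto
  then obtain \<sigma> where \<sigma>: "valid_path \<sigma>" "path_image \<sigma> \<subseteq> S" "pathstart \<sigma> = p" "pathfinish \<sigma> = pathstart \<gamma>"
    using connecting_path[OF S p] by blast
  define \<delta> where "\<delta> = \<sigma> +++ (\<gamma> +++ reversepath \<sigma>)"
  have "loop_in S \<delta>"
    using vp cl sub \<sigma> unfolding loop_in_def \<delta>_def
    by (auto simp: path_image_join intro!: valid_path_join)
  moreover have "contour_integral \<delta> g = contour_integral \<gamma> g" if g: "g holomorphic_on S" for g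
  proof -
    have "g contour_integrable_on \<gamma>" "g contour_integrable_on \<sigma>"
      using contour_integrable_holomorphic_simple[OF g S(1)] vp sub \<sigma> by auto
    then show ?thesis
      using vp cl \<sigma> unfolding \<delta>_def
      by (simp add: contour_integrable_reversepath contour_integral_reversepath valid_path_join)
  qed
  ultimately show ?thesis
    using that[of \<delta>] \<sigma>(3) by (simp add: \<delta>_def)
qed

lemma loop_multiple:
  assumes S: "open S" and \<gamma>: "loop_in S \<gamma>"
  obtains \<delta> where "loop_in S \<delta>" "pathstart \<delta> = pathstart \<gamma>"
    "\<And>g. g holomorphic_on S \<Longrightarrow> contour_integral \<delta> g = of_int n * contour_integral \<gamma> g"
proof -
  have "\<exists>\<delta>. loop_in S \<delta> \<and> pathstart \<delta> = pathstart \<gamma> \<and>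
      (\<forall>g. g holomorphic_on S \<longrightarrow> contour_integral \<delta> g = of_nat m * contour_integral \<gamma> g)" for m
  proof (induction m)
    case 0
    have "pathstart \<gamma> \<in> S" using \<gamma> by (auto simp: loop_in_def)
    moreover define \<epsilon> where "\<epsilon> = linepath (pathstart \<gamma>) (pathstart \<gamma>)"
    have "valid_path \<epsilon>" "pathstart \<epsilon> = pathstart \<gamma>" "pathfinish \<epsilon> = pathstart \<gamma>"
      "path_image \<epsilon> = {pathstart \<gamma>}" "\<And>g. contour_integral \<epsilon> g = 0"
      unfolding \<epsilon>_def
      by (simp_all only: valid_path_linepath pathstart_linepath pathfinish_linepath path_image_linepath
          closed_segment_idem contour_integral_trivial)
    ultimately show ?case
      by (intro exI[of _ \<epsilon>]) (auto simp: loop_in_def)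
  next
    case (Suc m)
    then obtain \<delta> where \<delta>: "loop_in S \<delta>" "pathstart \<delta> = pathstart \<gamma>"
      "\<And>g. g holomorphic_on S \<Longrightarrow> contour_integral \<delta> g = of_nat m * contour_integral \<gamma> g"
      by blast
    have "contour_integral (\<gamma> +++ \<delta>) g = of_nat (Suc m) * contour_integral \<gamma> g"
      if g: "g holomorphic_on S" for g
      using loop_integrable[OF \<gamma> g S] loop_integrable[OF \<delta>(1) g S] \<delta>(3)[OF g] \<gamma> \<delta>(1)
      by (simp add: loop_in_def algebra_simps)
    moreover have "loop_in S (\<gamma> +++ \<delta>)"
      using \<gamma> \<delta>(1,2) by (auto simp: loop_in_def path_image_join intro!: valid_path_join)
    ultimately show ?case
      by (intro exI[of _ "\<gamma> +++ \<delta>"]) auto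
  qed
  then obtain \<delta> where \<delta>: "loop_in S \<delta>" "pathstart \<delta> = pathstart \<gamma>"
    "\<And>g. g holomorphic_on S \<Longrightarrow> contour_integral \<delta> g = of_nat (nat \<bar>n\<bar>) * contour_integral \<gamma> g"
    by blast
  show ?thesis
  proof (cases "n \<ge> 0")
    case True
    then show ?thesis using that[OF \<delta>(1,2)] \<delta>(3) by simp
  next
    case False
    have "contour_integral (reversepath \<delta>) g = of_int n * contour_integral \<gamma> g"
      if "g holomorphic_on S" for g
      using \<delta>(1) \<delta>(3)[OF that] False by (simp add: loop_in_def contour_integral_reversepath)
    moreover have "loop_in S (reversepath \<delta>)" "pathstart (reversepath \<delta>) = pathstart \<gamma>"
      using \<delta>(1,2) by (auto simp: loop_in_def)
    ultimately show ?thesis using that by blast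
  qed
qed

text \<open>Integer combinations of loops are realised by single loops, so that Cauchy's theorem for closed
  paths can be used where one would naturally argue with cycles.\<close>
lemma loop_combination:
  assumes S: "open S" "connected S" and \<gamma>1: "loop_in S \<gamma>1" and \<gamma>2: "loop_in S \<gamma>2"
  obtains \<gamma> where "loop_in S \<gamma>"
    "\<And>g. g holomorphic_on S \<Longrightarrow>
       contour_integral \<gamma> g = of_int a * contour_integral \<gamma>1 g + of_int b * contour_integral \<gamma>2 g"
proof -
  have p: "pathstart \<gamma>1 \<in> S" using \<gamma>1 by (auto simp: loop_in_def)
  obtain \<delta>1 where \<delta>1: "loop_in S \<delta>1" "pathstart \<delta>1 = pathstart \<gamma>1"
    "\<And>g. g holomorphic_on S \<Longrightarrow> contour_integral \<delta>1 g = of_int a * contour_integral \<gamma>1 g"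
    using loop_multiple[OF S(1) \<gamma>1] by metis
  obtain \<gamma>3 where \<gamma>3: "loop_in S \<gamma>3" "pathstart \<gamma>3 = pathstart \<gamma>1"
    "\<And>g. g holomorphic_on S \<Longrightarrow> contour_integral \<gamma>3 g = contour_integral \<gamma>2 g"
    using loop_rebase[OF S \<gamma>2 p] by metis
  obtain \<delta>2 where \<delta>2: "loop_in S \<delta>2" "pathstart \<delta>2 = pathstart \<gamma>1"
    "\<And>g. g holomorphic_on S \<Longrightarrow> contour_integral \<delta>2 g = of_int b * contour_integral \<gamma>3 g"
    using loop_multiple[OF S(1) \<gamma>3(1)] \<gamma>3(2) by metis
  show ?thesis
  proof
    show "loop_in S (\<delta>1 +++ \<delta>2)"
      using \<delta>1 \<delta>2 by (auto simp: loop_in_def path_image_join intro!: valid_path_join)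
    show "contour_integral (\<delta>1 +++ \<delta>2) g = of_int a * contour_integral \<gamma>1 g + of_int b * contour_integral \<gamma>2 g"
      if g: "g holomorphic_on S" for g
      using loop_integrable[OF \<delta>1(1) g S(1)] loop_integrable[OF \<delta>2(1) g S(1)] \<delta>1 \<delta>2 \<gamma>3(3) g
      by (simp add: loop_in_def)
  qed
qed

section \<open>Loops that separate two holes\<close>

text \<open>The potential at \<open>x\<close> is the integral of \<open>q\<close> along a chosen path from a base point to \<open>x\<close>. Increments
  along segments are all that is used below.\<close>
lemma potential_on_segments:
  assumes S: "open S" "connected S" and q: "q holomorphic_on S"
    and loops: "\<And>\<gamma>. loop_in S \<gamma> \<Longrightarrow> contour_integral \<gamma> q = 0"
  obtains L where "\<And>x y. closed_segment x y \<subseteq> S \<Longrightarrow> contour_integral (linepath x y) q = L y - L x"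
proof (cases "S = {}")
  case True
  show ?thesis by (rule that[of "\<lambda>_. 0"]) (use True in auto)
next
  case False
  then obtain z0 where z0: "z0 \<in> S" by blast
  have "\<forall>x\<in>S. \<exists>\<sigma>. valid_path \<sigma> \<and> path_image \<sigma> \<subseteq> S \<and> pathstart \<sigma> = z0 \<and> pathfinish \<sigma> = x"
    using connecting_path[OF S z0] by metis
  then obtain \<sigma> where \<sigma>: "\<And>x. x \<in> S \<Longrightarrow> valid_path (\<sigma> x) \<and> path_image (\<sigma> x) \<subseteq> S \<and>
      pathstart (\<sigma> x) = z0 \<and> pathfinish (\<sigma> x) = x"
    by metis
  show ?thesis
  proof (rule that)
    fix x y assume seg: "closed_segment x y \<subseteq> S"
    then have xy: "x \<in> S" "y \<in> S" by auto
    define \<gamma> where "\<gamma> = \<sigma> x +++ (linepath x y +++ reversepath (\<sigma> y))"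
    have "loop_in S \<gamma>"
      using \<sigma>[OF xy(1)] \<sigma>[OF xy(2)] seg unfolding \<gamma>_def loop_in_def
      by (auto simp: path_image_join intro!: valid_path_join)
    then have "contour_integral \<gamma> q = 0" by (rule loops)
    moreover have "q contour_integrable_on \<sigma> x" "q contour_integrable_on \<sigma> y" "q contour_integrable_on linepath x y"
      using contour_integrable_holomorphic_simple[OF q S(1)] \<sigma>[OF xy(1)] \<sigma>[OF xy(2)] seg by auto
    ultimately have "contour_integral (\<sigma> x) q +
        (contour_integral (linepath x y) q - contour_integral (\<sigma> y) q) = 0"
      using \<sigma>[OF xy(1)] \<sigma>[OF xy(2)] unfolding \<gamma>_def
      by (simp add: contour_integrable_reversepath contour_integral_reversepath valid_path_join)
    then show "contour_integral (linepath x y) q =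
        contour_integral (\<sigma> y) q - contour_integral (\<sigma> x) q"
      by algebra
  qed
qed

text \<open>Overlay a square grid so fine that every square meeting \<open>K\<close> lies in \<open>V\<close>, with \<open>p\<close> the centre of one
  square. The integrals over the boundaries of the squares that meet \<open>K\<close> add up to \<open>2 \<pi> \<i> a\<close>. Edges
  between two such squares cancel; the remaining edges avoid \<open>K\<close>, so there the integral is an increment of
  \<open>L\<close>. Subtracting the increments of \<open>L\<close> around each square, whose sum is zero, leaves nothing.\<close>
lemma residue_zero_of_potential:
  fixes a p :: complex
  assumes K: "compact K" "K \<subseteq> V" and V: "open V" and p: "p \<in> K" and r: "r holomorphic_on V"
    and L: "\<And>x y. closed_segment x y \<subseteq> V - K \<Longrightarrow>
              contour_integral (linepath x y) (\<lambda>z. a / (z - p) + r z) = L y - L x"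
  shows "a = 0"
proof -
  obtain e where e: "e > 0" "(\<Union>x\<in>K. cball x e) \<subseteq> V"
    using compact_subset_open_imp_cball_epsilon_subset[OF K(1) V K(2)] by blast
  \<comment> \<open>Two points of a square of side \<open>e / 2\<close> have distance at most \<open>e\<close>.\<close>
  define \<delta> where "\<delta> = e / 2"
  have \<delta>: "\<delta> > 0" using e by (simp add: \<delta>_def)
  define X where "X i = Re p + \<delta> * (real_of_int i - 1/2)" for i
  define Y where "Y j = Im p + \<delta> * (real_of_int j - 1/2)" for j
  define pt where "pt i j = Complex (X i) (Y j)" for i j
  define sq where "sq i j = cbox (pt i j) (pt (i + 1) (j + 1))" for i j
  define Q where "Q = {(i, j). sq i j \<inter> K \<noteq> {}}"
  define h where "h z = a / (z - p) + r z" for z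
  have X1: "X (i + 1) = X i + \<delta>" and Y1: "Y (i + 1) = Y i + \<delta>" for i
    by (simp_all add: X_def Y_def algebra_simps)
  have sq_iff: "z \<in> sq i j \<longleftrightarrow> X i \<le> Re z \<and> Re z \<le> X i + \<delta> \<and> Y j \<le> Im z \<and> Im z \<le> Y j + \<delta>" for z i j
    by (auto simp: sq_def pt_def in_cbox_complex_iff X1 Y1)
  have half: "x - 1/2 \<noteq> 0" if "x \<in> \<int>" for x :: real
  proof
    assume "x - 1/2 = 0"
    then have "2 * x = 1" by simp
    moreover obtain k where "x = of_int k" using \<open>x \<in> \<int>\<close> by (auto elim: Ints_cases)
    ultimately have "real_of_int (2 * k) = real_of_int 1" by simp
    then have "2 * k = 1" by (simp only: of_int_eq_iff)
    then show False by presburger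
  qed
  have XY_ne: "X i \<noteq> Re p" "Y i \<noteq> Im p" for i
    using half[of "of_int i"] \<delta> by (auto simp: X_def Y_def)
  have sq_V: "sq i j \<subseteq> V" if ij: "(i, j) \<in> Q" for i j
  proof
    fix z assume z: "z \<in> sq i j"
    obtain w where w: "w \<in> sq i j" "w \<in> K" using ij unfolding Q_def by blast
    have "\<bar>Re (w - z)\<bar> \<le> \<delta>" "\<bar>Im (w - z)\<bar> \<le> \<delta>"
      using z w unfolding sq_iff by auto
    then have "dist w z \<le> e"
      using cmod_le[of "w - z"] by (simp add: dist_norm \<delta>_def)
    then show "z \<in> V" using w e(2) by (meson UN_I mem_cball subsetD)
  qed
  have "finite Q"
  proof -
    obtain B where B: "\<And>z. z \<in> K \<Longrightarrow> cmod (z - p) \<le> B"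
      using compact_imp_bounded[OF K(1)] unfolding bounded_any_center[of _ p] 
      by (auto simp: dist_norm norm_minus_commute)
    define M where "M = \<lceil>B / \<delta>\<rceil> + 2"
    have "\<bar>i\<bar> \<le> M" if "x \<le> q" "q \<le> x + \<delta>" "\<bar>q - c\<bar> \<le> B" "x = c + \<delta> * (real_of_int i - 1/2)" for i x q c
    proof -
      have "\<delta> * \<bar>real_of_int i\<bar> \<le> B + 2 * \<delta>"
      proof -
        have "\<bar>x - c\<bar> \<le> B + \<delta>" using that(1-3) by arith
        moreover have "\<delta> * real_of_int i = (x - c) + \<delta> / 2"
          using that(4) by (simp add: algebra_simps)
        ultimately have "\<bar>\<delta> * real_of_int i\<bar> \<le> B + 2 * \<delta>" using \<delta> by arith
        then show ?thesis using \<delta> by (simp add: abs_mult)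
      qed
      then have "\<bar>real_of_int i\<bar> \<le> B / \<delta> + 2"
        using \<delta> by (simp add: field_simps)
      also have "\<dots> \<le> real_of_int M" by (simp add: M_def)
      finally show ?thesis by linarith
    qed
    note bnd = this
    have "Q \<subseteq> {-M..M} \<times> {-M..M}"
    proof clarify
      fix i j assume "(i, j) \<in> Q"
      then obtain w where w: "w \<in> sq i j" "w \<in> K" unfolding Q_def by blast
      have "\<bar>Re w - Re p\<bar> \<le> B" "\<bar>Im w - Im p\<bar> \<le> B"
        using B[OF w(2)] abs_Re_le_cmod[of "w - p"] abs_Im_le_cmod[of "w - p"] by auto
      then have "\<bar>i\<bar> \<le> M" "\<bar>j\<bar> \<le> M"
        using bnd[of "X i" "Re w" "Re p" i] bnd[of "Y j" "Im w" "Im p" j] w(1)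
        by (auto simp: sq_iff X_def Y_def)
      then show "i \<in> {-M..M} \<and> j \<in> {-M..M}" by auto
    qed
    then show ?thesis by (rule finite_subset) simp
  qed
  have "p \<in> sq 0 0"
    using \<delta> by (simp add: sq_iff X_def Y_def)
  then have "(0, 0) \<in> Q"
    using p unfolding Q_def by blast
  \<comment> \<open>Integrals over horizontal and vertical edges, and the corresponding increments of the potential.
    \<open>L\<close> is a total function, so the increments are defined on edges meeting \<open>K\<close> too.\<close>
  define H where "H i j = contour_integral (linepath (pt i j) (pt (i + 1) j)) h" for i j
  define W where "W i j = contour_integral (linepath (pt i j) (pt i (j + 1))) h" for i j
  define H' where "H' i j = L (pt (i + 1) j) - L (pt i j)" for i j
  define W' where "W' i j = L (pt i (j + 1)) - L (pt i j)" for i j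
  have hseg: "closed_segment (pt i j) (pt (i + 1) j) = {z. Im z = Y j \<and> X i \<le> Re z \<and> Re z \<le> X i + \<delta>}" for i j
    using \<delta> closed_segment_same_Im[of "pt i j" "pt (i + 1) j"]
    by (auto simp: pt_def X1 closed_segment_eq_real_ivl)
  have vseg: "closed_segment (pt i j) (pt i (j + 1)) = {z. Re z = X i \<and> Y j \<le> Im z \<and> Im z \<le> Y j + \<delta>}" for i j
    using \<delta> closed_segment_same_Re[of "pt i j" "pt i (j + 1)"]
    by (auto simp: pt_def Y1 closed_segment_eq_real_ivl)
  have edges: "closed_segment (pt i j) (pt (i + 1) j) \<subseteq> sq i j"
    "closed_segment (pt i (j + 1)) (pt (i + 1) (j + 1)) \<subseteq> sq i j"
    "closed_segment (pt i j) (pt i (j + 1)) \<subseteq> sq i j"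
    "closed_segment (pt (i + 1) j) (pt (i + 1) (j + 1)) \<subseteq> sq i j" for i j
    unfolding hseg vseg using \<delta> by (auto simp: sq_iff X1 Y1)
  have p_edges: "p \<notin> closed_segment (pt i j) (pt (i + 1) j)" "p \<notin> closed_segment (pt i j) (pt i (j + 1))" for i j
    unfolding hseg vseg using XY_ne[of i] XY_ne[of j] by auto
  have h_cont: "continuous_on (V - {p}) h"
  proof -
    have "continuous_on (V - {p}) r"
      by (rule continuous_on_subset[OF holomorphic_on_imp_continuous_on[OF r]]) auto
    then show ?thesis
      unfolding h_def[abs_def] by (auto intro!: continuous_intros)
  qed
  have h_int: "h contour_integrable_on linepath x y" if "closed_segment x y \<subseteq> V" "p \<notin> closed_segment x y" for x y
    using that by (intro contour_integrable_continuous_linepath continuous_on_subset[OF h_cont]) auto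
  have around: "contour_integral (rectpath (pt i j) (pt (i + 1) (j + 1))) h =
      H i j + W (i + 1) j - H i (j + 1) - W i j" if ij: "(i, j) \<in> Q" for i j
  proof -
    have int: "h contour_integrable_on linepath (pt i j) (pt (i + 1) j)"
      "h contour_integrable_on linepath (pt i (j + 1)) (pt (i + 1) (j + 1))"
      "h contour_integrable_on linepath (pt i j) (pt i (j + 1))"
      "h contour_integrable_on linepath (pt (i + 1) j) (pt (i + 1) (j + 1))"
      using edges[of i j] sq_V[OF ij] p_edges by (auto intro!: h_int)
    have rev: "h contour_integrable_on linepath (pt (i + 1) (j + 1)) (pt i (j + 1))"
      "h contour_integrable_on linepath (pt i (j + 1)) (pt i j)"
      "contour_integral (linepath (pt (i + 1) (j + 1)) (pt i (j + 1))) h = - H i (j + 1)"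
      "contour_integral (linepath (pt i (j + 1)) (pt i j)) h = - W i j"
      using contour_integrable_reversepath[OF _ int(2)] contour_integrable_reversepath[OF _ int(3)]
        contour_integral_reversepath[of "linepath (pt i (j + 1)) (pt (i + 1) (j + 1))" h]
        contour_integral_reversepath[of "linepath (pt i j) (pt i (j + 1))" h]
      by (auto simp: H_def W_def)
    have "rectpath (pt i j) (pt (i + 1) (j + 1)) =
        linepath (pt i j) (pt (i + 1) j) +++ linepath (pt (i + 1) j) (pt (i + 1) (j + 1)) +++
        linepath (pt (i + 1) (j + 1)) (pt i (j + 1)) +++ linepath (pt i (j + 1)) (pt i j)"
      by (simp add: rectpath_def Let_def pt_def)
    then show ?thesis
      using int rev by (simp add: valid_path_join H_def W_def)
  qed
  have enclosed: "contour_integral (rectpath (pt i j) (pt (i + 1) (j + 1))) h =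
      (if (i, j) = (0, 0) then 2 * pi * \<i> * a else 0)" if ij: "(i, j) \<in> Q" for i j
  proof -
    let ?R = "rectpath (pt i j) (pt (i + 1) (j + 1))"
    have img: "path_image ?R \<subseteq> sq i j"
      unfolding sq_def using \<delta> by (intro path_image_rectpath_subset_cbox) (auto simp: pt_def X1 Y1)
    have vp: "valid_path ?R" by simp
    have p_notin: "p \<notin> path_image ?R"
    proof -
      have "p \<notin> cbox (pt i j) (pt (i + 1) (j + 1)) - box (pt i j) (pt (i + 1) (j + 1))"
        using XY_ne[of i] XY_ne[of j] XY_ne[of "i + 1"] XY_ne[of "j + 1"]
        by (auto simp: in_cbox_complex_iff in_box_complex_iff pt_def)
      then show ?thesis
        using \<delta> by (subst path_image_rectpath_cbox_minus_box) (auto simp: pt_def X1 Y1)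
    qed
    have "(r has_contour_integral 0) ?R"
      using sq_V[OF ij] img
      by (intro Cauchy_theorem_convex_simple[of r "sq i j"] holomorphic_on_subset[OF r])
        (auto simp: sq_def)
    moreover have "((\<lambda>z. 1 / (z - p)) has_contour_integral (2 * pi * \<i> * winding_number ?R p)) ?R"
      by (rule has_contour_integral_winding_number[OF vp p_notin])
    ultimately have "((\<lambda>z. a * (1 / (z - p)) + r z) has_contour_integral
        a * (2 * pi * \<i> * winding_number ?R p) + 0) ?R"
      by (intro has_contour_integral_add has_contour_integral_lmul)
    then have "contour_integral ?R h = 2 * pi * \<i> * a * winding_number ?R p"
      by (auto dest!: contour_integral_unique simp: h_def[abs_def])
    moreover have "winding_number ?R p = (if (i, j) = (0, 0) then 1 else 0)"
    proof (cases "(i, j) = (0, 0)")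
      case True
      then show ?thesis
        using \<delta> by (auto intro!: winding_number_rectpath simp: in_box_complex_iff pt_def X_def Y_def)
    next
      case False
      have far: "\<not> (c + \<delta> * (real_of_int k - 1/2) \<le> c \<and> c \<le> c + \<delta> * (real_of_int k - 1/2) + \<delta>)"
        if "k \<noteq> 0" for k c
      proof
        assume "c + \<delta> * (real_of_int k - 1/2) \<le> c \<and> c \<le> c + \<delta> * (real_of_int k - 1/2) + \<delta>"
        then have "\<delta> * (real_of_int k - 1/2) \<le> 0" "0 \<le> \<delta> * (real_of_int k + 1/2)"
          by (auto simp: algebra_simps)
        then have "real_of_int k - 1/2 \<le> 0" "0 \<le> real_of_int k + 1/2"
          using \<delta> by (auto simp: mult_le_0_iff zero_le_mult_iff)
        then show False using that by linarith
      qed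
      have "p \<notin> sq i j"
        using False far[of i "Re p"] far[of j "Im p"] by (auto simp: sq_iff X_def Y_def)
      then show ?thesis
        using False \<delta> by (auto intro!: winding_number_rectpath_outside simp: sq_def pt_def X1 Y1)
    qed
    ultimately show ?thesis by simp
  qed
  define dH where "dH ij = (case ij of (i, j) \<Rightarrow> H i j - H' i j)" for ij
  define dW where "dW ij = (case ij of (i, j) \<Rightarrow> W i j - W' i j)" for ij
  have exact: "contour_integral (linepath x y) h = L y - L x" if "closed_segment x y \<subseteq> V - K" for x y
    using L[OF that] by (simp add: h_def[abs_def])
  have dH0: "dH (i, j) = 0" if "((i, j) \<in> Q) \<noteq> ((i, j - 1) \<in> Q)" for i j
  proof -
    have "closed_segment (pt i j) (pt (i + 1) j) \<subseteq> V - K"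
      using that edges(1)[of i j] edges(2)[of i "j - 1"] sq_V[of i j] sq_V[of i "j - 1"]
      by (auto simp: Q_def)
    then show ?thesis
      by (simp add: dH_def H_def H'_def exact)
  qed
  have dW0: "dW (i, j) = 0" if "((i, j) \<in> Q) \<noteq> ((i - 1, j) \<in> Q)" for i j
  proof -
    have "closed_segment (pt i j) (pt i (j + 1)) \<subseteq> V - K"
      using that edges(3)[of i j] edges(4)[of "i - 1" j] sq_V[of i j] sq_V[of "i - 1" j]
      by (auto simp: Q_def)
    then show ?thesis
      by (simp add: dW_def W_def W'_def exact)
  qed
  \<comment> \<open>The upper edges of the squares in \<open>Q\<close> are the lower edges of the shifted squares, and the two index
    sets differ only where \<open>dH\<close> vanishes. Likewise for the vertical edges.\<close>
  have "(\<Sum>ij\<in>Q. dH (fst ij, snd ij + 1)) = sum dH ((\<lambda>ij. (fst ij, snd ij + 1)) ` Q)"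
    by (subst sum.reindex) (auto simp: inj_on_def prod_eq_iff)
  also have "\<dots> = sum dH Q"
  proof (rule sum.mono_neutral_cong)
    show "dH ij = 0" if "ij \<in> Q - (\<lambda>ij. (fst ij, snd ij + 1)) ` Q" for ij
    proof (cases ij)
      case (Pair i j)
      then have "(i, j - 1) \<notin> Q" using that by force
      then show ?thesis using dH0[of i j] that Pair by auto
    qed
    show "dH ij = 0" if "ij \<in> (\<lambda>ij. (fst ij, snd ij + 1)) ` Q - Q" for ij
    proof (cases ij)
      case (Pair i j)
      then have "(i, j - 1) \<in> Q" using that by force
      then show ?thesis using dH0[of i j] that Pair by auto
    qed
  qed (use \<open>finite Q\<close> in auto)
  finally have sumH: "(\<Sum>ij\<in>Q. dH (fst ij, snd ij + 1)) = sum dH Q" .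
  have "(\<Sum>ij\<in>Q. dW (fst ij + 1, snd ij)) = sum dW ((\<lambda>ij. (fst ij + 1, snd ij)) ` Q)"
    by (subst sum.reindex) (auto simp: inj_on_def prod_eq_iff)
  also have "\<dots> = sum dW Q"
  proof (rule sum.mono_neutral_cong)
    show "dW ij = 0" if "ij \<in> Q - (\<lambda>ij. (fst ij + 1, snd ij)) ` Q" for ij
    proof (cases ij)
      case (Pair i j)
      then have "(i - 1, j) \<notin> Q" using that by force
      then show ?thesis using dW0[of i j] that Pair by auto
    qed
    show "dW ij = 0" if "ij \<in> (\<lambda>ij. (fst ij + 1, snd ij)) ` Q - Q" for ij
    proof (cases ij)
      case (Pair i j)
      then have "(i - 1, j) \<in> Q" using that by force
      then show ?thesis using dW0[of i j] that Pair by auto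
    qed
  qed (use \<open>finite Q\<close> in auto)
  finally have sumW: "(\<Sum>ij\<in>Q. dW (fst ij + 1, snd ij)) = sum dW Q" .
  have "2 * pi * \<i> * a = (\<Sum>ij\<in>Q. if ij = (0, 0) then 2 * pi * \<i> * a else 0)"
    using \<open>finite Q\<close> \<open>(0, 0) \<in> Q\<close> by simp
  also have "\<dots> = (\<Sum>ij\<in>Q. dH ij + dW (fst ij + 1, snd ij) - dH (fst ij, snd ij + 1) - dW ij)"
  proof (rule sum.cong)
    fix ij assume "ij \<in> Q"
    obtain i j where ij: "ij = (i, j)" by (cases ij)
    then have "(if ij = (0, 0) then 2 * pi * \<i> * a else 0) = H i j + W (i + 1) j - H i (j + 1) - W i j"
      using enclosed[of i j] around[of i j] \<open>ij \<in> Q\<close> by simp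
    also have "\<dots> = dH ij + dW (fst ij + 1, snd ij) - dH (fst ij, snd ij + 1) - dW ij"
      by (simp add: ij dH_def dW_def H'_def W'_def)
    finally show "(if ij = (0, 0) then 2 * pi * \<i> * a else 0) =
        dH ij + dW (fst ij + 1, snd ij) - dH (fst ij, snd ij + 1) - dW ij" .
  qed simp
  also have "\<dots> = 0"
    using sumH sumW by (simp add: sum.distrib sum_subtractf)
  finally show ?thesis by simp
qed

text \<open>By the theorem of Sura and Bura the compact component \<open>C\<close> of the complement has a compact neighbourhood
  \<open>K\<close> in the complement that is relatively open and avoids \<open>p'\<close>. Then \<open>\<Omega> \<union> K\<close> is open and the
  preceding lemma applies: \<open>a / (z - p) + b / (z - p')\<close> has a potential on \<open>\<Omega>\<close>, and its second
  summand is holomorphic on \<open>\<Omega> \<union> K\<close>.\<close>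
lemma hole_residue_zero:
  assumes \<Omega>: "complex_domain \<Omega>" and C: "C \<in> holes \<Omega>" and p: "p \<in> C" and p': "p' \<notin> \<Omega>" "p' \<notin> C"
    and loops: "\<And>\<gamma>. loop_in \<Omega> \<gamma> \<Longrightarrow> a * winding_number \<gamma> p + b * winding_number \<gamma> p' = 0"
  shows "a = 0"
proof -
  have op: "open \<Omega>" and conn: "connected \<Omega>"
    using \<Omega> by (auto simp: complex_domain_def)
  have comp: "C \<in> components (- \<Omega>)" "bounded C"
    using C by (auto simp: holes_def)
  have "closed (- \<Omega>)" using op by (simp add: closed_Compl)
  then have "closed C" using closed_components comp(1) by blast
  then have "compact C" using comp(2) compact_eq_bounded_closed by blast
  moreover have "locally compact (- \<Omega>)"
    using \<open>closed (- \<Omega>)\<close> closed_imp_locally_compact by blast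
  moreover have "open (- {p'})" "C \<subseteq> - {p'}" using p'(2) by auto
  ultimately obtain K where K: "openin (top_of_set (- \<Omega>)) K" "compact K" "C \<subseteq> K" "K \<subseteq> - {p'}"
    using Sura_Bura_clopen_subset comp(1) by metis
  then obtain G where G: "open G" "K = - \<Omega> \<inter> G"
    by (auto simp: openin_open)
  define V where "V = \<Omega> \<union> G"
  have "open V" using op G(1) by (auto simp: V_def)
  have VK: "p' \<notin> V" "K \<subseteq> V" "V - K \<subseteq> \<Omega>"
    using G(2) p'(1) K(4) by (auto simp: V_def)
  have pn: "p \<notin> \<Omega>" using p comp(1) in_components_subset by blast
  have hol: "(\<lambda>z. a / (z - p) + b / (z - p')) holomorphic_on \<Omega>"
    using pn p'(1) by (intro holomorphic_intros) auto
  have "contour_integral \<gamma> (\<lambda>z. a / (z - p) + b / (z - p')) = 0" if \<gamma>: "loop_in \<Omega> \<gamma>" for \<gamma>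
  proof -
    have "valid_path \<gamma>" "p \<notin> path_image \<gamma>" "p' \<notin> path_image \<gamma>"
      using \<gamma> pn p'(1) by (auto simp: loop_in_def)
    then have "((\<lambda>z. a * (1 / (z - p)) + b * (1 / (z - p'))) has_contour_integral
        a * (2 * pi * \<i> * winding_number \<gamma> p) + b * (2 * pi * \<i> * winding_number \<gamma> p')) \<gamma>"
      by (intro has_contour_integral_add has_contour_integral_lmul has_contour_integral_winding_number)
    then have "contour_integral \<gamma> (\<lambda>z. a / (z - p) + b / (z - p')) =
        2 * pi * \<i> * (a * winding_number \<gamma> p + b * winding_number \<gamma> p')"
      by (auto dest!: contour_integral_unique simp: algebra_simps)
    then show ?thesis using loops[OF \<gamma>] by simp
  qed
  then obtain L where L: "\<And>x y. closed_segment x y \<subseteq> \<Omega> \<Longrightarrow>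
      contour_integral (linepath x y) (\<lambda>z. a / (z - p) + b / (z - p')) = L y - L x"
    using potential_on_segments[OF op conn hol] by blast
  show ?thesis
  proof (rule residue_zero_of_potential[OF K(2) VK(2) \<open>open V\<close>])
    show "p \<in> K" using p K(3) by blast
    show "(\<lambda>z. b / (z - p')) holomorphic_on V"
      using VK(1) by (intro holomorphic_intros) auto
    show "contour_integral (linepath x y) (\<lambda>z. a / (z - p) + b / (z - p')) = L y - L x"
      if "closed_segment x y \<subseteq> V - K" for x y
      using that VK(3) by (intro L) blast
  qed
qed

text \<open>If all these determinants vanished, the winding numbers around \<open>p1\<close> and \<open>p2\<close> would satisfy one linear
  relation valid for all loops, with coefficients that are zero by the preceding lemma.\<close>
lemma independent_loops:
  assumes \<Omega>: "complex_domain \<Omega>" and C: "C1 \<in> holes \<Omega>" "C2 \<in> holes \<Omega>" "C1 \<noteq> C2"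
    and p: "p1 \<in> C1" "p2 \<in> C2"
  obtains \<gamma>1 \<gamma>2 where "loop_in \<Omega> \<gamma>1" "loop_in \<Omega> \<gamma>2"
    "winding_number \<gamma>1 p1 * winding_number \<gamma>2 p2 \<noteq> winding_number \<gamma>1 p2 * winding_number \<gamma>2 p1"
proof (rule ccontr)
  assume "\<not> thesis"
  with that have dep: "winding_number \<gamma>1 p1 * winding_number \<gamma>2 p2 = winding_number \<gamma>1 p2 * winding_number \<gamma>2 p1"
    if "loop_in \<Omega> \<gamma>1" "loop_in \<Omega> \<gamma>2" for \<gamma>1 \<gamma>2
    using that by blast
  have comp: "C1 \<in> components (- \<Omega>)" "C2 \<in> components (- \<Omega>)"
    using C by (auto simp: holes_def)
  then have "C1 \<inter> C2 = {}" using C(3) components_nonoverlap by blast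
  then have pn: "p1 \<notin> \<Omega>" "p2 \<notin> \<Omega>" "p1 \<notin> C2" "p2 \<notin> C1"
    using p comp in_components_subset by blast+
  have "\<exists>\<gamma>. loop_in \<Omega> \<gamma> \<and> winding_number \<gamma> p1 \<noteq> 0"
    using hole_residue_zero[OF \<Omega> C(1) p(1) pn(2,4), of 1 0] by auto
  then obtain \<gamma> where \<gamma>: "loop_in \<Omega> \<gamma>" "winding_number \<gamma> p1 \<noteq> 0" by blast
  have "winding_number \<gamma> p1 = 0"
  proof (rule hole_residue_zero[OF \<Omega> C(2) p(2) pn(1,3)])
    show "winding_number \<gamma> p1 * winding_number \<gamma>2 p2 + (- winding_number \<gamma> p2) * winding_number \<gamma>2 p1 = 0"
      if "loop_in \<Omega> \<gamma>2" for \<gamma>2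
      using dep[OF \<gamma>(1) that] by simp
  qed
  then show False using \<gamma>(2) by simp
qed

section \<open>Limits of sequences of self-maps\<close>

lemma infinitely_often_subsequence:
  assumes inf: "\<exists>\<^sub>\<infinity>n. P n"
  obtains r :: "nat \<Rightarrow> nat" where "strict_mono r" "\<And>n. P (r n)"
  using infinite_enumerate[of "{n. P n}"] inf unfolding INFM_iff_infinite by auto

text \<open>After an affine change of the values, the omitted values are 0 and 1, and Schottky's theorem bounds
  functions that are bounded at one point. Where the values at that point are large, the reciprocals,
  which omit 0 and 1 as well, are bounded; by Hurwitz their limit has no zeros or vanishes
  identically, and in the latter case the functions themselves tend to infinity.\<close>
lemma normal_family_omitting_two_values:
  assumes S: "open S" "connected S" "S \<noteq> {}" and p: "p1 \<noteq> p2"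
    and hol: "\<And>n :: nat. h n holomorphic_on S"
    and omit: "\<And>n z. z \<in> S \<Longrightarrow> h n z \<noteq> p1 \<and> h n z \<noteq> p2"
  obtains (finite_limit) r g where "strict_mono (r :: nat \<Rightarrow> nat)" "g holomorphic_on S"
      "\<And>K. compact K \<Longrightarrow> K \<subseteq> S \<Longrightarrow> uniform_limit K (\<lambda>n. h (r n)) g sequentially"
    | (infinite_limit) r where "strict_mono (r :: nat \<Rightarrow> nat)"
      "\<And>K R. compact K \<Longrightarrow> K \<subseteq> S \<Longrightarrow> \<forall>\<^sub>F n in sequentially. \<forall>z\<in>K. R < cmod (h (r n) z)"
proof -
  obtain w where w: "w \<in> S" using S(3) by blast
  define d where "d = p2 - p1"
  have d: "d \<noteq> 0" using p by (simp add: d_def)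
  define k where "k n z = (h n z - p1) / d" for n z
  have k_hol: "k n holomorphic_on S" for n
    unfolding k_def[abs_def] using d by (intro holomorphic_intros hol) auto
  have k_omit: "k n z \<noteq> 0 \<and> k n z \<noteq> 1" if "z \<in> S" for n z
    using omit[OF that, of n] d by (auto simp: k_def d_def)
  have h_k: "h n z = p1 + d * k n z" for n z
    using d by (simp add: k_def)
  have montel: "\<exists>r g. strict_mono r \<and> g holomorphic_on S \<and>
      (\<forall>K. compact K \<longrightarrow> K \<subseteq> S \<longrightarrow> uniform_limit K (\<lambda>n. u (r n)) g sequentially)"
    if u: "\<And>n. u n holomorphic_on S" "\<And>n z. z \<in> S \<Longrightarrow> u n z \<noteq> 0 \<and> u n z \<noteq> 1"
      "\<And>n. cmod (u n w) \<le> 1" for u :: "nat \<Rightarrow> complex \<Rightarrow> complex"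
  proof -
    have bounded: "\<exists>B. \<forall>v\<in>range u. \<forall>z\<in>K. cmod (v z) \<le> B" if "compact K" "K \<subseteq> S" for K
      using GPicard3[OF S(1,2) w order_refl, of "range u" K] u that by (metis (no_types, lifting) rangeE)
    show ?thesis
    proof (rule Montel[OF S(1) _ bounded order_refl])
      show "v holomorphic_on S" if "v \<in> range u" for v
        using that u(1) by auto
    qed (auto simp: comp_def)
  qed
  have from_k: thesis
    if r: "strict_mono (r :: nat \<Rightarrow> nat)" and g: "g holomorphic_on S"
      and lim: "\<And>K. compact K \<Longrightarrow> K \<subseteq> S \<Longrightarrow> uniform_limit K (\<lambda>n. k (r n)) g sequentially" for r g
  proof (rule finite_limit[OF r])
    show "(\<lambda>z. p1 + d * g z) holomorphic_on S"
      by (intro holomorphic_intros g)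
    fix K assume "compact K" "K \<subseteq> S"
    then have "uniform_limit K (\<lambda>n z. p1 + d * k (r n) z) (\<lambda>z. p1 + d * g z) sequentially"
      by (intro uniform_limit_intros lim)
    then show "uniform_limit K (\<lambda>n. h (r n)) (\<lambda>z. p1 + d * g z) sequentially"
      by (simp add: h_k[abs_def])
  qed
  show thesis
  proof (cases "\<exists>\<^sub>\<infinity>n. cmod (k n w) \<le> 1")
    case True
    then obtain r0 :: "nat \<Rightarrow> nat" where r0: "strict_mono r0" "\<And>n. cmod (k (r0 n) w) \<le> 1"
      by (rule infinitely_often_subsequence) blast
    obtain r g where r: "strict_mono r" "g holomorphic_on S"
      "\<And>K. compact K \<Longrightarrow> K \<subseteq> S \<Longrightarrow> uniform_limit K (\<lambda>n. k (r0 (r n))) g sequentially"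
      using montel[of "\<lambda>n. k (r0 n)"] k_hol k_omit r0(2) by blast
    show thesis
      using from_k[of "r0 \<circ> r" g] strict_mono_o[OF r0(1) r(1)] r(2,3) by simp
  next
    case False
    then have "\<exists>\<^sub>\<infinity>n. 1 < cmod (k n w)"
      by (auto simp: not_INFM not_le intro: MOST_INFM)
    then obtain r0 :: "nat \<Rightarrow> nat" where r0: "strict_mono r0" "\<And>n. 1 < cmod (k (r0 n) w)"
      by (rule infinitely_often_subsequence) blast
    define u where "u n z = inverse (k (r0 n) z)" for n z
    have u: "u n holomorphic_on S" "z \<in> S \<Longrightarrow> u n z \<noteq> 0 \<and> u n z \<noteq> 1" "cmod (u n w) \<le> 1" for n z
    proof -
      show "u n holomorphic_on S"
        unfolding u_def[abs_def] using k_omit by (intro holomorphic_intros k_hol) blast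
      show "u n z \<noteq> 0 \<and> u n z \<noteq> 1" if "z \<in> S"
        using k_omit[OF that] by (auto simp: u_def)
      show "cmod (u n w) \<le> 1"
        using r0(2)[of n] by (simp add: u_def norm_inverse inverse_le_1_iff)
    qed
    obtain r g where r: "strict_mono r" and g: "g holomorphic_on S"
      and lim: "\<And>K. compact K \<Longrightarrow> K \<subseteq> S \<Longrightarrow> uniform_limit K (\<lambda>n. u (r n)) g sequentially"
      using montel[of u] u by blast
    have mono: "strict_mono (r0 \<circ> r)" by (rule strict_mono_o[OF r0(1) r])
    show thesis
    proof (cases "\<exists>z\<in>S. g z = 0")
      case False
      have "uniform_limit K (\<lambda>n. k (r0 (r n))) (\<lambda>z. inverse (g z)) sequentially"
        if K: "compact K" "K \<subseteq> S" for K
      proof -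
        have "compact (g ` K)"
          using K g by (meson compact_continuous_image continuous_on_subset holomorphic_on_imp_continuous_on)
        moreover have "0 \<notin> g ` K" using False K by auto
        ultimately obtain b where b: "b > 0" "\<And>z. z \<in> K \<Longrightarrow> b \<le> cmod (g z)"
          using separate_point_closed[OF compact_imp_closed, of "g ` K" 0] by (auto simp: dist_norm)
        have "uniform_limit K (\<lambda>n z. inverse (u (r n) z)) (inverse \<circ> g) sequentially"
          by (rule uniform_lim_inverse[OF lim[OF K] b(2) b(1)])
        then show ?thesis by (simp add: u_def comp_def)
      qed
      then show thesis
        using from_k[of "r0 \<circ> r" "\<lambda>z. inverse (g z)"] mono g False
        by (auto intro!: holomorphic_intros)
    next
      case True
      then obtain z1 where z1: "z1 \<in> S" "g z1 = 0" by blast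
      have "g constant_on S"
      proof (rule ccontr)
        assume "\<not> g constant_on S"
        then have "g z1 \<noteq> 0"
          using Hurwitz_no_zeros[OF S(1,2), of "\<lambda>n. u (r n)" g z1] u g lim z1(1) by blast
        then show False using z1(2) by simp
      qed
      then have g0: "g z = 0" if "z \<in> S" for z
        using that z1 unfolding constant_on_def by metis
      show thesis
      proof (rule infinite_limit[OF mono])
        fix K R assume K: "compact K" "K \<subseteq> S"
        define B where "B = (\<bar>R\<bar> + cmod p1 + 1) / cmod d"
        have B: "B > 0"
          using d by (simp add: B_def add_nonneg_pos)
        have "\<forall>\<^sub>F n in sequentially. \<forall>z\<in>K. dist (u (r n) z) (g z) < inverse B"
          using lim[OF K] B unfolding uniform_limit_iff by simp
        then show "\<forall>\<^sub>F n in sequentially. \<forall>z\<in>K. R < cmod (h ((r0 \<circ> r) n) z)"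
        proof (rule eventually_mono, intro ballI)
          fix n z assume ev: "\<forall>z\<in>K. dist (u (r n) z) (g z) < inverse B" and z: "z \<in> K"
          let ?k = "k (r0 (r n)) z"
          have zS: "z \<in> S" using z K by blast
          have "inverse (cmod ?k) < inverse B"
            using ev z g0[OF zS] by (auto simp: u_def dist_norm norm_inverse)
          then have "B < cmod ?k"
            using B k_omit[OF zS, of "r0 (r n)"] by (simp add: inverse_less_iff_less)
          then have "\<bar>R\<bar> + cmod p1 + 1 < cmod (d * ?k)"
            using d by (simp add: B_def field_simps norm_mult)
          also have "\<dots> \<le> cmod (h (r0 (r n)) z) + cmod p1"
            using norm_triangle_ineq4[of "h (r0 (r n)) z" p1] h_k[of "r0 (r n)" z] by simp
          finally show "R < cmod (h ((r0 \<circ> r) n) z)" by simp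
        qed
      qed
    qed
  qed
qed

text \<open>If \<open>g\<close> takes a value \<open>c\<close> outside \<open>D\<close>, it is a limit of functions that never take the value \<open>c\<close>, so it is
  constant by Hurwitz.\<close>
lemma limit_inside_or_constant:
  assumes S: "open S" "connected S" and hol: "\<And>n :: nat. h n holomorphic_on S" "g holomorphic_on S"
    and maps: "\<And>n. h n ` S \<subseteq> D"
    and lim: "\<And>K. compact K \<Longrightarrow> K \<subseteq> S \<Longrightarrow> uniform_limit K h g sequentially"
  shows "g ` S \<subseteq> D \<or> (\<exists>c. c \<notin> D \<and> (\<forall>z\<in>S. g z = c))"
proof (rule disjCI)
  assume no: "\<not> (\<exists>c. c \<notin> D \<and> (\<forall>z\<in>S. g z = c))"
  show "g ` S \<subseteq> D"
  proof (rule ccontr)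
    assume "\<not> g ` S \<subseteq> D"
    then obtain z0 where z0: "z0 \<in> S" "g z0 \<notin> D" by blast
    have "\<not> g constant_on S"
      using no z0 unfolding constant_on_def by metis
    then have nonconst: "\<not> (\<lambda>z. g z - g z0) constant_on S"
      unfolding constant_on_def by (metis diff_add_cancel)
    have "g z0 - g z0 \<noteq> 0"
    proof (rule Hurwitz_no_zeros[OF S _ _ _ nonconst _ z0(1)])
      show "(\<lambda>z. h n z - g z0) holomorphic_on S" "(\<lambda>z. g z - g z0) holomorphic_on S" for n
        by (intro holomorphic_intros hol)+
      show "uniform_limit K (\<lambda>n z. h n z - g z0) (\<lambda>z. g z - g z0) sequentially"
        if "compact K" "K \<subseteq> S" for K
        by (intro uniform_limit_intros lim that)
      show "h n z - g z0 \<noteq> 0" if "z \<in> S" for n z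
        using maps[of n] that z0(2) by auto
    qed
    then show False by simp
  qed
qed

lemma eventually_in_compact:
  fixes h :: "nat \<Rightarrow> complex \<Rightarrow> complex"
  assumes D: "open D" and K: "compact K" and g: "continuous_on K g" "g ` K \<subseteq> D"
    and lim: "uniform_limit K h g sequentially"
  obtains L where "compact L" "L \<subseteq> D" "\<forall>\<^sub>F n in sequentially. h n ` K \<subseteq> L"
proof -
  have comp: "compact (g ` K)" by (rule compact_continuous_image[OF g(1) K])
  obtain e where e: "e > 0" "(\<Union>x\<in>g ` K. cball x e) \<subseteq> D"
    using compact_subset_open_imp_cball_epsilon_subset[OF comp D g(2)] by blast
  have "\<forall>\<^sub>F n in sequentially. \<forall>z\<in>K. dist (h n z) (g z) < e"
    using lim e(1) unfolding uniform_limit_iff by blast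
  then have "\<forall>\<^sub>F n in sequentially. h n ` K \<subseteq> (\<Union>x\<in>g ` K. cball x e)"
    by (rule eventually_mono) (force simp: dist_commute)
  then show ?thesis
    using that[OF compact_minkowski_sum_cball[OF comp] e(2)] by blast
qed

lemma frequently_of_subsequence:
  assumes "strict_mono (r :: nat \<Rightarrow> nat)" "\<forall>\<^sub>F n in sequentially. P (r n)"
  shows "\<exists>\<^sub>\<infinity>n. P n"
  unfolding INFM_nat
proof
  fix m
  obtain M where M: "\<And>n. n \<ge> M \<Longrightarrow> P (r n)"
    using assms(2) unfolding eventually_sequentially by blast
  have "Suc (max M m) \<le> r (Suc (max M m))"
    by (rule seq_suble[OF assms(1)])
  then show "\<exists>n>m. P n"
    using M[of "Suc (max M m)"] by (intro exI[of _ "r (Suc (max M m))"]) auto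
qed

section \<open>Winding numbers of loops near the boundary\<close>

lemma winding_number_loop_integral:
  assumes "loop_in S \<gamma>" "w \<notin> S"
  shows "contour_integral \<gamma> (\<lambda>z. 1 / (z - w)) = 2 * pi * \<i> * winding_number \<gamma> w"
  using assms by (intro contour_integral_unique has_contour_integral_winding_number) (auto simp: loop_in_def)

text \<open>Such a point lies in an unbounded component of the complement, which the loop does not meet.\<close>
lemma winding_number_zero_off_holes:
  assumes \<sigma>: "loop_in \<Omega> \<sigma>" and w: "w \<notin> \<Omega>" "w \<notin> \<Union>(holes \<Omega>)"
  shows "winding_number \<sigma> w = 0"
proof (rule winding_number_zero_in_outside)
  show "path \<sigma>" "pathfinish \<sigma> = pathstart \<sigma>"
    using \<sigma> by (auto simp: loop_in_def valid_path_imp_path)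
  have sub: "- \<Omega> \<subseteq> - path_image \<sigma>"
    using \<sigma> by (auto simp: loop_in_def)
  have "connected_component_set (- \<Omega>) w \<in> components (- \<Omega>)" "w \<in> connected_component_set (- \<Omega>) w"
    using w(1) by (auto simp: components_def)
  then have "\<not> bounded (connected_component_set (- \<Omega>) w)"
    using w(2) unfolding holes_def by blast
  then have "\<not> bounded (connected_component_set (- path_image \<sigma>) w)"
    using connected_component_mono[OF sub, of w] bounded_subset by blast
  then show "w \<in> outside (path_image \<sigma>)"
    using w(1) sub by (auto simp: outside_def)
qed

text \<open>Close to \<open>c\<close> there are only points of the component of \<open>c\<close> in the complement and of unbounded
  components, because the other holes form a closed set. If the component of \<open>c\<close> is unbounded, both sides
  of the equation are zero.\<close>
lemma winding_number_near_omitted_point: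
  assumes \<Omega>: "open \<Omega>" and fin: "finitely_connected \<Omega>" and c: "c \<notin> \<Omega>"
  obtains e where "e > 0" "\<And>\<sigma> w. loop_in \<Omega> \<sigma> \<Longrightarrow> path_image \<sigma> \<subseteq> ball c e \<Longrightarrow> w \<notin> \<Omega> \<Longrightarrow>
      winding_number \<sigma> w = (if w \<in> connected_component_set (- \<Omega>) c then winding_number \<sigma> c else 0)"
proof -
  define C where "C = connected_component_set (- \<Omega>) c"
  have C: "C \<in> components (- \<Omega>)" "c \<in> C"
    using c by (auto simp: C_def components_def)
  have "closed (\<Union>(holes \<Omega> - {C}))"
  proof (rule closed_Union)
    show "finite (holes \<Omega> - {C})" using fin by (simp add: finitely_connected_def)
    show "\<forall>X\<in>holes \<Omega> - {C}. closed X"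
      using \<Omega> closed_components[of "- \<Omega>"] by (auto simp: holes_def closed_Compl)
  qed
  moreover have "c \<notin> \<Union>(holes \<Omega> - {C})"
    using C components_nonoverlap[of C "- \<Omega>"] by (auto simp: holes_def)
  ultimately obtain e where e: "e > 0" "ball c e \<subseteq> - \<Union>(holes \<Omega> - {C})"
    by (metis ComplI open_Compl open_contains_ball)
  have "winding_number \<sigma> w = (if w \<in> C then winding_number \<sigma> c else 0)"
    if \<sigma>: "loop_in \<Omega> \<sigma>" "path_image \<sigma> \<subseteq> ball c e" and w: "w \<notin> \<Omega>" for \<sigma> w
  proof -
    have path: "path \<sigma>" "pathfinish \<sigma> = pathstart \<sigma>" "path_image \<sigma> \<subseteq> \<Omega>"
      using \<sigma>(1) by (auto simp: loop_in_def valid_path_imp_path)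
    show ?thesis
    proof (cases "w \<in> C")
      case True
      have "C \<inter> path_image \<sigma> = {}"
        using in_components_subset[OF C(1)] path(3) by blast
      then show ?thesis
        using True C winding_number_eq[OF path(1,2) True C(2) in_components_connected[OF C(1)]] by simp
    next
      case False
      have "winding_number \<sigma> w = 0"
      proof (cases "w \<in> \<Union>(holes \<Omega>)")
        case True
        then have "w \<in> \<Union>(holes \<Omega> - {C})" using False by blast
        then have "w \<notin> ball c e" using e(2) by blast
        then show ?thesis
          using winding_number_zero_outside[OF path(1) convex_ball path(2) _ \<sigma>(2)] by blast
      qed (use winding_number_zero_off_holes[OF \<sigma>(1) w] in blast)
      then show ?thesis using False by simp
    qed
  qed
  then show ?thesis using that e(1) unfolding C_def by blast
qed

text \<open>All holes lie in a disc that contains 0. Winding numbers of a loop outside this disc are constant on it.\<close>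
lemma winding_number_near_infinity:
  assumes fin: "finitely_connected \<Omega>"
  obtains R where "\<And>\<sigma> w. loop_in \<Omega> \<sigma> \<Longrightarrow> path_image \<sigma> \<inter> ball 0 R = {} \<Longrightarrow> w \<notin> \<Omega> \<Longrightarrow>
      winding_number \<sigma> w = (if w \<in> \<Union>(holes \<Omega>) then winding_number \<sigma> 0 else 0)" "R > 0"
proof -
  have "bounded (\<Union>(holes \<Omega>))"
    using fin by (intro bounded_Union) (auto simp: finitely_connected_def holes_def)
  then obtain R where R: "R > 0" "\<Union>(holes \<Omega>) \<subseteq> ball 0 R"
    using bounded_subset_ballD by blast
  have "winding_number \<sigma> w = (if w \<in> \<Union>(holes \<Omega>) then winding_number \<sigma> 0 else 0)"
    if \<sigma>: "loop_in \<Omega> \<sigma>" "path_image \<sigma> \<inter> ball 0 R = {}" and w: "w \<notin> \<Omega>" for \<sigma> w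
  proof (cases "w \<in> \<Union>(holes \<Omega>)")
    case True
    have path: "path \<sigma>" "pathfinish \<sigma> = pathstart \<sigma>"
      using \<sigma>(1) by (auto simp: loop_in_def valid_path_imp_path)
    have "winding_number \<sigma> w = winding_number \<sigma> 0"
      using True R \<sigma>(2) by (intro winding_number_eq[OF path, of _ "ball 0 R"]) auto
    then show ?thesis using True by simp
  qed (use winding_number_zero_off_holes[OF \<sigma>(1) w] in simp)
  then show ?thesis using that R(1) by blast
qed

section \<open>Iterates return to compact sets\<close>

context supercyclic_vector
begin

text \<open>Let \<open>a\<close>, \<open>b\<close> be integers, not both zero, with \<open>a N1 + b N2 = 0\<close>. The image of the combination
  \<open>a \<gamma>1 + b \<gamma>2\<close> does not wind around any point outside \<open>\<Omega>\<close>, so it is null, and so is the combination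
  itself. Its winding numbers around \<open>p1\<close> and \<open>p2\<close> are then zero, which contradicts the independence.\<close>
lemma iterate_windings_not_proportional:
  fixes N1 N2 :: int
  assumes \<gamma>: "loop_in \<Omega> \<gamma>1" "loop_in \<Omega> \<gamma>2" and p: "p1 \<notin> \<Omega>" "p2 \<notin> \<Omega>"
    and indep: "winding_number \<gamma>1 p1 * winding_number \<gamma>2 p2 \<noteq> winding_number \<gamma>1 p2 * winding_number \<gamma>2 p1"
    and wind: "\<And>w. w \<notin> \<Omega> \<Longrightarrow> winding_number ((\<psi> ^^ n) \<circ> \<gamma>1) w = of_int N1 * of_bool (w \<in> D)"
      "\<And>w. w \<notin> \<Omega> \<Longrightarrow> winding_number ((\<psi> ^^ n) \<circ> \<gamma>2) w = of_int N2 * of_bool (w \<in> D)"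
  shows False
proof -
  obtain a b :: int where ab: "a \<noteq> 0 \<or> b \<noteq> 0" "a * N1 + b * N2 = 0"
  proof (cases "N1 = 0 \<and> N2 = 0")
    case True
    then show ?thesis using that[of 1 0] by simp
  next
    case False
    then show ?thesis using that[of N2 "- N1"] by auto
  qed
  obtain \<gamma> where \<gamma>0: "loop_in \<Omega> \<gamma>" and comb: "\<And>g. g holomorphic_on \<Omega> \<Longrightarrow>
      contour_integral \<gamma> g = of_int a * contour_integral \<gamma>1 g + of_int b * contour_integral \<gamma>2 g"
    using loop_combination[OF open_\<Omega> connected_\<Omega> \<gamma>, of a b] by blast
  let ?h = "\<psi> ^^ n"
  have h: "?h holomorphic_on \<Omega>" "?h ` \<Omega> \<subseteq> \<Omega>"
    by (rule iterate_holomorphic iterate_self)+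
  note image_loop = loop_in_compose[OF _ h(1) open_\<Omega> h(2)]
  have comb_h: "contour_integral (?h \<circ> \<gamma>) g =
      of_int a * contour_integral (?h \<circ> \<gamma>1) g + of_int b * contour_integral (?h \<circ> \<gamma>2) g"
    if g: "g holomorphic_on \<Omega>" for g
  proof -
    have "(g \<circ> ?h) holomorphic_on \<Omega>"
      using holomorphic_on_compose_gen[OF h(1) g h(2)] .
    then have "(\<lambda>w. deriv ?h w * g (?h w)) holomorphic_on \<Omega>"
      unfolding comp_def by (intro holomorphic_intros holomorphic_deriv[OF h(1) open_\<Omega>])
    then show ?thesis
      using comb contour_integral_compose[OF _ h(1) open_\<Omega>] \<gamma> \<gamma>0 by simp
  qed
  have pole: "(\<lambda>z. 1 / (z - w)) holomorphic_on \<Omega>" if "w \<notin> \<Omega>" for w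
    using that by (intro holomorphic_intros) auto
  have "winding_number (?h \<circ> \<gamma>) w = 0" if w: "w \<notin> \<Omega>" for w
  proof -
    have "2 * pi * \<i> * winding_number (?h \<circ> \<gamma>) w = of_int a * (2 * pi * \<i> * winding_number (?h \<circ> \<gamma>1) w) +
        of_int b * (2 * pi * \<i> * winding_number (?h \<circ> \<gamma>2) w)"
      using comb_h[OF pole[OF w]] winding_number_loop_integral[OF image_loop w] \<gamma> \<gamma>0 by metis
    also have "\<dots> = 2 * pi * \<i> * of_bool (w \<in> D) * of_int (a * N1 + b * N2)"
      by (simp add: wind[OF w] algebra_simps)
    finally show ?thesis by (simp add: ab(2))
  qed
  then have "null_loop \<Omega> (?h \<circ> \<gamma>)"
    using image_loop[OF \<gamma>0] unfolding null_loop_def loop_in_def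
    by (metis Cauchy_theorem_global contour_integral_unique open_\<Omega>)
  then have null: "null_loop \<Omega> \<gamma>"
    by (rule null_loop_iterate_pullback[OF \<gamma>0])
  have "of_int a * winding_number \<gamma>1 w + of_int b * winding_number \<gamma>2 w = 0" if w: "w \<notin> \<Omega>" for w
  proof -
    have "0 = contour_integral \<gamma> (\<lambda>z. 1 / (z - w))"
      using null pole[OF w] by (simp add: null_loop_def)
    also have "\<dots> = 2 * pi * \<i> * (of_int a * winding_number \<gamma>1 w + of_int b * winding_number \<gamma>2 w)"
      unfolding comb[OF pole[OF w]] winding_number_loop_integral[OF \<gamma>(1) w]
        winding_number_loop_integral[OF \<gamma>(2) w] by (simp add: algebra_simps)
    finally show ?thesis by simp
  qed
  from this[OF p(1)] this[OF p(2)]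
  have "of_int a * (winding_number \<gamma>1 p1 * winding_number \<gamma>2 p2 - winding_number \<gamma>1 p2 * winding_number \<gamma>2 p1) = 0"
    "of_int b * (winding_number \<gamma>1 p1 * winding_number \<gamma>2 p2 - winding_number \<gamma>1 p2 * winding_number \<gamma>2 p1) = 0"
    by algebra+
  then show False
    using ab(1) indep by auto
qed

text \<open>The two excluded kinds of limit, a constant outside \<open>\<Omega>\<close> and infinity, would send two independent loops
  to loops whose winding numbers are multiples of one indicator function: that of the component of the
  constant, or that of the union of all holes.\<close>
lemma return_of_two_holes:
  fixes s :: "nat \<Rightarrow> nat"
  assumes fin: "finitely_connected \<Omega>" and card: "card (holes \<Omega>) \<ge> 2"
    and K: "compact K" "K \<subseteq> \<Omega>"
  shows "\<exists>K'. compact K' \<and> K' \<subseteq> \<Omega> \<and> (\<exists>\<^sub>\<infinity>j. (\<psi> ^^ s j) ` K \<subseteq> K')"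
proof -
  have \<Omega>: "complex_domain \<Omega>"
    using open_\<Omega> connected_\<Omega> nonempty_\<Omega> by (simp add: complex_domain_def)
  obtain C1 C2 where C: "C1 \<in> holes \<Omega>" "C2 \<in> holes \<Omega>" "C1 \<noteq> C2"
    using card fin unfolding finitely_connected_def
    by (metis card_2_iff' card_le_Suc0_iff_eq not_less_eq_eq numeral_2_eq_2)
  then have comp: "C1 \<in> components (- \<Omega>)" "C2 \<in> components (- \<Omega>)"
    by (auto simp: holes_def)
  then obtain p1 p2 where p: "p1 \<in> C1" "p2 \<in> C2"
    using in_components_nonempty by blast
  have "C1 \<inter> C2 = {}"
    using comp C(3) components_nonoverlap by blast
  then have pn: "p1 \<notin> \<Omega>" "p2 \<notin> \<Omega>" "p1 \<noteq> p2"
    using p comp in_components_subset by blast+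
  obtain \<gamma>1 \<gamma>2 where \<gamma>: "loop_in \<Omega> \<gamma>1" "loop_in \<Omega> \<gamma>2" and
    indep: "winding_number \<gamma>1 p1 * winding_number \<gamma>2 p2 \<noteq> winding_number \<gamma>1 p2 * winding_number \<gamma>2 p1"
    using independent_loops[OF \<Omega> C p] by blast
  define M where "M = path_image \<gamma>1 \<union> path_image \<gamma>2"
  have M: "compact M" "M \<subseteq> \<Omega>"
    using \<gamma> by (auto simp: M_def loop_in_def compact_valid_path_image)
  have images: "loop_in \<Omega> ((\<psi> ^^ n) \<circ> \<gamma>1)" "loop_in \<Omega> ((\<psi> ^^ n) \<circ> \<gamma>2)"
    "path_image ((\<psi> ^^ n) \<circ> \<gamma>1) \<subseteq> (\<psi> ^^ n) ` M" "path_image ((\<psi> ^^ n) \<circ> \<gamma>2) \<subseteq> (\<psi> ^^ n) ` M" for n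
    using loop_in_compose[OF _ iterate_holomorphic open_\<Omega> iterate_self] \<gamma>
    by (auto simp: path_image_compose M_def)
  have integer: "\<exists>N :: int. winding_number \<sigma> w = of_int N" if "loop_in S \<sigma>" "w \<notin> path_image \<sigma>" for S \<sigma> w
    using integer_winding_number[of \<sigma> w] that
    by (auto simp: loop_in_def valid_path_imp_path elim!: Ints_cases)
  have omit: "(\<psi> ^^ s n) z \<noteq> p1 \<and> (\<psi> ^^ s n) z \<noteq> p2" if "z \<in> \<Omega>" for n z
    using iterate_self[of "s n"] that pn by blast
  show ?thesis
  proof (rule normal_family_omitting_two_values[OF open_\<Omega> connected_\<Omega> nonempty_\<Omega> pn(3),
        of "\<lambda>n. \<psi> ^^ s n", OF iterate_holomorphic omit])
    fix r g
    assume r: "strict_mono (r :: nat \<Rightarrow> nat)" and g: "g holomorphic_on \<Omega>"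
      and lim: "\<And>K. compact K \<Longrightarrow> K \<subseteq> \<Omega> \<Longrightarrow> uniform_limit K (\<lambda>n. \<psi> ^^ s (r n)) g sequentially"
    have "g ` \<Omega> \<subseteq> \<Omega> \<or> (\<exists>c. c \<notin> \<Omega> \<and> (\<forall>z\<in>\<Omega>. g z = c))"
      by (rule limit_inside_or_constant[OF open_\<Omega> connected_\<Omega> iterate_holomorphic g iterate_self lim])
    then show ?thesis
    proof
      assume inside: "g ` \<Omega> \<subseteq> \<Omega>"
      have "continuous_on K g" "g ` K \<subseteq> \<Omega>"
        using holomorphic_on_imp_continuous_on[OF g] continuous_on_subset K(2) inside by blast+
      then obtain L where "compact L" "L \<subseteq> \<Omega>" "\<forall>\<^sub>F n in sequentially. (\<psi> ^^ s (r n)) ` K \<subseteq> L"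
        using eventually_in_compact[OF open_\<Omega> K(1) _ _ lim[OF K]] by blast
      then show ?thesis
        using frequently_of_subsequence[OF r, of "\<lambda>n. (\<psi> ^^ s n) ` K \<subseteq> L"] by blast
    next
      assume "\<exists>c. c \<notin> \<Omega> \<and> (\<forall>z\<in>\<Omega>. g z = c)"
      then obtain c where c: "c \<notin> \<Omega>" "\<And>z. z \<in> \<Omega> \<Longrightarrow> g z = c" by blast
      obtain e where e: "e > 0" and wind: "\<And>\<sigma> w. loop_in \<Omega> \<sigma> \<Longrightarrow> path_image \<sigma> \<subseteq> ball c e \<Longrightarrow> w \<notin> \<Omega> \<Longrightarrow>
          winding_number \<sigma> w = (if w \<in> connected_component_set (- \<Omega>) c then winding_number \<sigma> c else 0)"
        using winding_number_near_omitted_point[OF open_\<Omega> fin c(1)] by blast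
      have "\<forall>\<^sub>F n in sequentially. \<forall>z\<in>M. dist ((\<psi> ^^ s (r n)) z) (g z) < e"
        using lim[OF M] e unfolding uniform_limit_iff by blast
      then obtain m where "\<forall>z\<in>M. dist ((\<psi> ^^ s (r m)) z) (g z) < e"
        using eventually_happens'[OF sequentially_bot] by blast
      then have near: "(\<psi> ^^ s (r m)) ` M \<subseteq> ball c e"
        using M(2) c(2) by (force simp: dist_commute)
      define n where "n = s (r m)"
      have off: "c \<notin> path_image ((\<psi> ^^ n) \<circ> \<gamma>1)" "c \<notin> path_image ((\<psi> ^^ n) \<circ> \<gamma>2)"
        using images(1,2)[of n] c(1) by (auto simp: loop_in_def)
      obtain N1 N2 :: int where N: "winding_number ((\<psi> ^^ n) \<circ> \<gamma>1) c = of_int N1"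
        "winding_number ((\<psi> ^^ n) \<circ> \<gamma>2) c = of_int N2"
        using integer[OF images(1) off(1)] integer[OF images(2) off(2)] by blast
      have False
        by (rule iterate_windings_not_proportional[OF \<gamma> pn(1,2) indep,
              of n N1 "connected_component_set (- \<Omega>) c" N2])
          (use wind[OF images(1)] wind[OF images(2)] images(3,4)[of n] near N in \<open>auto simp: n_def[symmetric]\<close>)
      then show ?thesis ..
    qed
  next
    fix r
    assume r: "strict_mono (r :: nat \<Rightarrow> nat)"
      and lim: "\<And>K R. compact K \<Longrightarrow> K \<subseteq> \<Omega> \<Longrightarrow> \<forall>\<^sub>F n in sequentially. \<forall>z\<in>K. R < cmod ((\<psi> ^^ s (r n)) z)"
    obtain R where wind: "\<And>\<sigma> w. loop_in \<Omega> \<sigma> \<Longrightarrow> path_image \<sigma> \<inter> ball 0 R = {} \<Longrightarrow> w \<notin> \<Omega> \<Longrightarrow>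
        winding_number \<sigma> w = (if w \<in> \<Union>(holes \<Omega>) then winding_number \<sigma> 0 else 0)" and R: "R > 0"
      using winding_number_near_infinity[OF fin] by blast
    obtain m where m: "\<And>z. z \<in> M \<Longrightarrow> R < cmod ((\<psi> ^^ s (r m)) z)"
      using eventually_happens'[OF sequentially_bot lim[OF M, of R]] by blast
    define n where "n = s (r m)"
    have far: "(\<psi> ^^ n) ` M \<inter> ball 0 R = {}"
      using m by (force simp: n_def)
    then have far1: "path_image ((\<psi> ^^ n) \<circ> \<gamma>1) \<inter> ball 0 R = {}"
      "path_image ((\<psi> ^^ n) \<circ> \<gamma>2) \<inter> ball 0 R = {}"
      using images(3,4)[of n] by blast+
    moreover have "0 \<in> ball (0::complex) R" using R by simp
    ultimately have off: "0 \<notin> path_image ((\<psi> ^^ n) \<circ> \<gamma>1)" "0 \<notin> path_image ((\<psi> ^^ n) \<circ> \<gamma>2)"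
      by blast+
    obtain N1 N2 :: int where N: "winding_number ((\<psi> ^^ n) \<circ> \<gamma>1) 0 = of_int N1"
      "winding_number ((\<psi> ^^ n) \<circ> \<gamma>2) 0 = of_int N2"
      using integer[OF images(1) off(1)] integer[OF images(2) off(2)] by blast
    have False
      by (rule iterate_windings_not_proportional[OF \<gamma> pn(1,2) indep, of n N1 "\<Union>(holes \<Omega>)" N2])
        (use wind[OF images(1) far1(1)] wind[OF images(2) far1(2)] N in simp_all)
    then show ?thesis ..
  qed
qed

text \<open>After transport to the annulus a constant limit \<open>c\<close> outside it satisfies \<open>|c| \<ge> 1\<close>. A loop in
  \<open>ball c (1/2)\<close> does not wind around 0, nor then around any point of the closed unit disc, so some iterate
  would map the core circle of \<open>\<Omega>\<close> to a null loop. But \<open>F' / F\<close> has integral \<open>2 \<pi> \<i>\<close> over that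
  circle.\<close>
lemma return_of_annulus:
  fixes s :: "nat \<Rightarrow> nat"
  assumes \<rho>: "\<rho> > 1" and equiv: "conformally_equivalent \<Omega> (annulus \<rho>)"
    and K: "compact K" "K \<subseteq> \<Omega>"
  shows "\<exists>K'. compact K' \<and> K' \<subseteq> \<Omega> \<and> (\<exists>\<^sub>\<infinity>j. (\<psi> ^^ s j) ` K \<subseteq> K')"
proof -
  define A where "A = annulus \<rho>"
  have A_iff: "z \<in> A \<longleftrightarrow> 1 < cmod z \<and> cmod z < \<rho>" for z
    by (simp add: A_def annulus_def)
  have "A = {z. 1 < cmod z} \<inter> {z. cmod z < \<rho>}"
    using A_iff by auto
  then have op: "open A"
    by (simp add: open_Int open_Collect_less continuous_intros)
  obtain F G where F: "F holomorphic_on \<Omega>" "\<And>z. z \<in> \<Omega> \<Longrightarrow> F z \<in> A" and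
    G: "G holomorphic_on A" "\<And>w. w \<in> A \<Longrightarrow> G w \<in> \<Omega>" and
    inv: "\<And>z. z \<in> \<Omega> \<Longrightarrow> G (F z) = z" "\<And>w. w \<in> A \<Longrightarrow> F (G w) = w"
    using equiv unfolding conformally_equivalent_def A_def by blast
  define \<Phi> where "\<Phi> n = F \<circ> (\<psi> ^^ n)" for n
  have \<Phi>_hol: "\<Phi> n holomorphic_on \<Omega>" for n
    unfolding \<Phi>_def by (rule holomorphic_on_compose_gen[OF iterate_holomorphic F(1) iterate_self])
  have \<Phi>_A: "\<Phi> n ` \<Omega> \<subseteq> A" for n
    using F(2) iterate_self[of n] by (auto simp: \<Phi>_def)
  have bounded: "\<exists>B. \<forall>v\<in>range (\<lambda>n. \<Phi> (s n)). \<forall>z\<in>L. cmod (v z) \<le> B"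
    if "compact L" "L \<subseteq> \<Omega>" for L
  proof (intro exI ballI)
    fix v z assume "v \<in> range (\<lambda>n. \<Phi> (s n))" "z \<in> L"
    then have "v z \<in> A" using \<Phi>_A that by blast
    then show "cmod (v z) \<le> \<rho>" by (simp add: A_iff)
  qed
  have "\<exists>g r. g holomorphic_on \<Omega> \<and> strict_mono (r :: nat \<Rightarrow> nat) \<and>
      (\<forall>L. compact L \<longrightarrow> L \<subseteq> \<Omega> \<longrightarrow> uniform_limit L (\<lambda>n. \<Phi> (s (r n))) g sequentially)"
  proof (rule Montel[OF open_\<Omega> _ bounded order_refl])
    show "v holomorphic_on \<Omega>" if "v \<in> range (\<lambda>n. \<Phi> (s n))" for v
      using that \<Phi>_hol by auto
  qed (auto simp: comp_def)
  then obtain g r where g: "g holomorphic_on \<Omega>" and r: "strict_mono (r :: nat \<Rightarrow> nat)"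
    and lim: "\<And>L. compact L \<Longrightarrow> L \<subseteq> \<Omega> \<Longrightarrow> uniform_limit L (\<lambda>n. \<Phi> (s (r n))) g sequentially"
    by blast
  have "g ` \<Omega> \<subseteq> A \<or> (\<exists>c. c \<notin> A \<and> (\<forall>z\<in>\<Omega>. g z = c))"
    by (rule limit_inside_or_constant[OF open_\<Omega> connected_\<Omega> \<Phi>_hol g \<Phi>_A lim])
  then show ?thesis
  proof
    assume inside: "g ` \<Omega> \<subseteq> A"
    have "continuous_on K g" "g ` K \<subseteq> A"
      using holomorphic_on_imp_continuous_on[OF g] continuous_on_subset K(2) inside by blast+
    then obtain L where L: "compact L" "L \<subseteq> A" "\<forall>\<^sub>F n in sequentially. \<Phi> (s (r n)) ` K \<subseteq> L"
      using eventually_in_compact[OF op K(1) _ _ lim[OF K]] by blast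
    have "compact (G ` L)"
      by (rule compact_continuous_image[OF continuous_on_subset[OF
            holomorphic_on_imp_continuous_on[OF G(1)] L(2)] L(1)])
    moreover have "G ` L \<subseteq> \<Omega>" using G(2) L(2) by blast
    moreover have "\<exists>\<^sub>\<infinity>j. (\<psi> ^^ s j) ` K \<subseteq> G ` L"
    proof (rule frequently_of_subsequence[OF r])
      show "\<forall>\<^sub>F n in sequentially. (\<psi> ^^ s (r n)) ` K \<subseteq> G ` L"
        using L(3)
      proof (rule eventually_mono, intro subsetI)
        fix n w assume n: "\<Phi> (s (r n)) ` K \<subseteq> L" and "w \<in> (\<psi> ^^ s (r n)) ` K"
        then obtain z where z: "z \<in> K" "w = (\<psi> ^^ s (r n)) z" by blast
        then have "w \<in> \<Omega>"
          using iterate_self[of "s (r n)"] K(2) by blast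
        then have "w = G (\<Phi> (s (r n)) z)"
          using inv(1) z(2) by (simp add: \<Phi>_def)
        then show "w \<in> G ` L" using n z(1) by blast
      qed
    qed
    ultimately show ?thesis by blast
  next
    assume "\<exists>c. c \<notin> A \<and> (\<forall>z\<in>\<Omega>. g z = c)"
    then obtain c where c: "c \<notin> A" "\<And>z. z \<in> \<Omega> \<Longrightarrow> g z = c" by blast
    define t where "t = (1 + \<rho>) / 2"
    have t: "1 < t" "t < \<rho>" "0 < t" using \<rho> by (auto simp: t_def)
    define \<gamma> where "\<gamma> = G \<circ> circlepath 0 t"
    have circle_A: "circlepath 0 t x \<in> A" for x
      using t by (simp add: A_iff circlepath norm_mult norm_exp_eq_Re)
    have "loop_in A (circlepath 0 t)"
      using t by (auto simp: loop_in_def A_iff)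
    then have \<gamma>: "loop_in \<Omega> \<gamma>"
      unfolding \<gamma>_def using G op by (intro loop_in_compose[of A]) auto
    have \<gamma>_in: "\<gamma> x \<in> \<Omega>" for x
      using G(2) circle_A by (simp add: \<gamma>_def)
    have F\<gamma>: "F \<circ> \<gamma> = circlepath 0 t"
      using inv(2) circle_A by (auto simp: \<gamma>_def)
    have M: "compact (path_image \<gamma>)" "path_image \<gamma> \<subseteq> \<Omega>"
      using \<gamma> by (auto simp: loop_in_def compact_valid_path_image)
    have "\<forall>\<^sub>F n in sequentially. \<forall>z\<in>path_image \<gamma>. dist (\<Phi> (s (r n)) z) (g z) < 1/2"
      using lim[OF M] unfolding uniform_limit_iff by (meson half_gt_zero zero_less_one)
    then obtain m where m: "\<And>z. z \<in> path_image \<gamma> \<Longrightarrow> dist (\<Phi> (s (r m)) z) (g z) < 1/2"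
      using eventually_happens'[OF sequentially_bot] by blast
    have c_ge: "1 \<le> cmod c"
    proof -
      obtain z where z: "z \<in> \<Omega>" using nonempty_\<Omega> by blast
      have "(\<lambda>n. \<Phi> (s (r n)) z) \<longlonglongrightarrow> c"
        using tendsto_uniform_limitI[OF lim[of "{z}"]] z c(2) by auto
      then have "(\<lambda>n. cmod (\<Phi> (s (r n)) z)) \<longlonglongrightarrow> cmod c"
        by (rule tendsto_norm)
      moreover have "1 \<le> cmod (\<Phi> (s (r n)) z)" for n
        using \<Phi>_A[of "s (r n)"] z A_iff by (meson image_subset_iff less_imp_le)
      ultimately show ?thesis
        using LIMSEQ_le_const by blast
    qed
    define n where "n = s (r m)"
    define \<sigma> where "\<sigma> = \<Phi> n \<circ> \<gamma>"
    have \<sigma>: "loop_in A \<sigma>"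
      unfolding \<sigma>_def by (rule loop_in_compose[OF \<gamma> \<Phi>_hol open_\<Omega> \<Phi>_A])
    have path: "path \<sigma>" "pathfinish \<sigma> = pathstart \<sigma>" "path_image \<sigma> \<subseteq> A" "valid_path \<sigma>"
      using \<sigma> by (auto simp: loop_in_def valid_path_imp_path)
    have near: "path_image \<sigma> \<subseteq> ball c (1/2)"
      using m M(2) c(2) by (force simp: \<sigma>_def path_image_compose n_def dist_commute)
    have "winding_number \<sigma> w = 0" if w: "w \<notin> A" for w
    proof (cases "cmod w \<le> 1")
      case True
      have "cball 0 1 \<inter> path_image \<sigma> = {}"
        using path(3) A_iff by force
      then have "winding_number \<sigma> w = winding_number \<sigma> 0"
        using True by (intro winding_number_eq[OF path(1,2), of _ "cball 0 1"]) auto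
      also have "\<dots> = 0"
        using c_ge by (intro winding_number_zero_outside[OF path(1) convex_ball path(2) _ near]) simp
      finally show ?thesis .
    next
      case False
      then have "w \<notin> ball 0 \<rho>" using w by (simp add: A_iff)
      moreover have "path_image \<sigma> \<subseteq> ball 0 \<rho>" using path(3) A_iff by auto
      ultimately show ?thesis
        by (intro winding_number_zero_outside[OF path(1) convex_ball path(2)])
    qed
    then have null_\<sigma>: "contour_integral \<sigma> q = 0" if "q holomorphic_on A" for q
      using Cauchy_theorem_global[OF op that path(4,2,3)] contour_integral_unique by blast
    have pull_back: "(\<psi> ^^ n) \<circ> \<gamma> = G \<circ> \<sigma>"
    proof
      fix x
      have "(\<psi> ^^ n) (\<gamma> x) \<in> \<Omega>"
        using iterate_self[of n] \<gamma>_in[of x] by blast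
      then show "((\<psi> ^^ n) \<circ> \<gamma>) x = (G \<circ> \<sigma>) x"
        using inv(1) by (simp add: \<sigma>_def \<Phi>_def)
    qed
    have "null_loop \<Omega> ((\<psi> ^^ n) \<circ> \<gamma>)"
      unfolding null_loop_def
    proof (intro allI impI)
      fix q assume q: "q holomorphic_on \<Omega>"
      have "(q \<circ> G) holomorphic_on A"
        using G by (intro holomorphic_on_compose_gen[OF G(1) q]) auto
      then have "(\<lambda>w. deriv G w * q (G w)) holomorphic_on A"
        unfolding comp_def by (intro holomorphic_intros holomorphic_deriv[OF G(1) op])
      then show "contour_integral ((\<psi> ^^ n) \<circ> \<gamma>) q = 0"
        unfolding pull_back contour_integral_compose[OF \<sigma> G(1) op] by (rule null_\<sigma>)
    qed
    then have null: "null_loop \<Omega> \<gamma>"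
      by (rule null_loop_iterate_pullback[OF \<gamma>])
    have "F z \<noteq> 0" if "z \<in> \<Omega>" for z
      using F(2)[OF that] by (auto simp: A_iff)
    then have "(\<lambda>z. deriv F z * (1 / (F z - 0))) holomorphic_on \<Omega>"
      by (intro holomorphic_intros holomorphic_deriv[OF F(1) open_\<Omega>] F(1)) auto
    then have "0 = contour_integral \<gamma> (\<lambda>z. deriv F z * (1 / (F z - 0)))"
      using null by (simp add: null_loop_def)
    also have "\<dots> = contour_integral (circlepath 0 t) (\<lambda>z. 1 / (z - 0))"
      unfolding F\<gamma>[symmetric] by (rule contour_integral_compose[OF \<gamma> F(1) open_\<Omega>, symmetric])
    also have "\<dots> = 2 * pi * \<i>"
      using contour_integral_circlepath[OF t(3), of 0] by (simp only: of_real_mult of_real_numeral)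
    finally have False by simp
    then show ?thesis ..
  qed
qed

end

theorem theorem1p5:
  fixes \<Omega> :: "complex set" and \<omega> \<psi> :: "complex \<Rightarrow> complex"
  assumes "complex_domain \<Omega>"
    and "finitely_connected \<Omega>"
    and "(\<exists>r>1. conformally_equivalent \<Omega> (annulus r)) \<or> card (holes \<Omega>) \<ge> 2"
    and "\<omega> holomorphic_on \<Omega>"
    and "\<psi> holomorphic_on \<Omega>"
    and "\<psi> ` \<Omega> \<subseteq> \<Omega>"
  shows "\<not> supercyclic_on fun_scale (hol_topology \<Omega>) (weighted_comp \<Omega> \<omega> \<psi>)"
proof
  assume "supercyclic_on fun_scale (hol_topology \<Omega>) (weighted_comp \<Omega> \<omega> \<psi>)"
  then obtain f where f: "f \<in> hol_space \<Omega>" "orbit_approximates \<Omega> (weighted_comp \<Omega> \<omega> \<psi>) f"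
    by (rule supercyclic_imp_orbit_approximates)
  interpret supercyclic_vector \<Omega> \<omega> \<psi> f
    using assms f by unfold_locales (auto simp: complex_domain_def)
  obtain z0 R where "z0 \<in> \<Omega>" and R: "R > 0" "cball z0 R \<subseteq> \<Omega>"
    using nonempty_\<Omega> open_\<Omega> open_contains_cball by blast
  have "\<exists>K. compact K \<and> K \<subseteq> \<Omega> \<and> (\<exists>\<^sub>\<infinity>j. (\<psi> ^^ s j) ` cball z0 R \<subseteq> K)" for s :: "nat \<Rightarrow> nat"
    using assms(3) return_of_annulus[OF _ _ compact_cball R(2)]
      return_of_two_holes[OF assms(2) _ compact_cball R(2)] by blast
  then show False
    by (rule no_disc_returns[OF R])
qed

end
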